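(* Let $R$ be a commutative ring with identity and let $I$ be an ideal of $R$. Then $R\bowtie I$ is a $PF$-ring if and only if $R$ is a $PF$-ring and $I$ is a pure ideal of $R$.
   Context: All rings are commutative with identity. A ring $R$ is called a $PF$-ring if every principal ideal of $R$ is flat (as an $R$-module). For an ideal $I$ of $R$, the amalgamated duplication of $R$ along $I$ is the subring $R\bowtie I=\{(r,r+i) : r\in R,\ i\in I\}$ of $R\times R$, with unit element $(1,1)$. An ideal $I$ of $R$ is pure if $I_{m}\in\{0,R_{m}\}$ for every maximal ideal $m$ of $R$ (where $I_m$ and $R_m$ denote localizations at $m$). *)

theory Defs
  imports "HOL-Algebra.Algebra" "HOL-Algebra.Free_Abelian_Groups"
begin

section \<open>Tensor products of modules over a commutative ring\<close>

definition module_hom ::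
  "('a, 'r) ring_scheme \<Rightarrow> ('a, 'b, 'm) module_scheme \<Rightarrow> ('a, 'c, 'n) module_scheme \<Rightarrow> ('b \<Rightarrow> 'c) set"
  where "module_hom R M N =
    {f \<in> carrier M \<rightarrow> carrier N.
       (\<forall>x\<in>carrier M. \<forall>y\<in>carrier M. f (x \<oplus>\<^bsub>M\<^esub> y) = f x \<oplus>\<^bsub>N\<^esub> f y) \<and>
       (\<forall>r\<in>carrier R. \<forall>x\<in>carrier M. f (r \<odot>\<^bsub>M\<^esub> x) = r \<odot>\<^bsub>N\<^esub> f x)}"

definition tensor_relations ::
  "('a, 'r) ring_scheme \<Rightarrow> ('a, 'b, 'm) module_scheme \<Rightarrow> ('a, 'c, 'n) module_scheme \<Rightarrow> ('b \<times> 'c \<Rightarrow>\<^sub>0 int) set"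
  where "tensor_relations R M N =
    {frag_of (x \<oplus>\<^bsub>M\<^esub> x', y) - frag_of (x, y) - frag_of (x', y) | x x' y.
       x \<in> carrier M \<and> x' \<in> carrier M \<and> y \<in> carrier N} \<union>
    {frag_of (x, y \<oplus>\<^bsub>N\<^esub> y') - frag_of (x, y) - frag_of (x, y') | x y y'.
       x \<in> carrier M \<and> y \<in> carrier N \<and> y' \<in> carrier N} \<union>
    {frag_of (r \<odot>\<^bsub>M\<^esub> x, y) - frag_of (x, r \<odot>\<^bsub>N\<^esub> y) | r x y.
       r \<in> carrier R \<and> x \<in> carrier M \<and> y \<in> carrier N}"

abbreviation tensor_free ::
  "('a, 'b, 'm) module_scheme \<Rightarrow> ('a, 'c, 'n) module_scheme \<Rightarrow> ('b \<times> 'c \<Rightarrow>\<^sub>0 int) monoid"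
  where "tensor_free M N \<equiv> free_Abelian_group (carrier M \<times> carrier N)"

definition tensor_kernel ::
  "('a, 'r) ring_scheme \<Rightarrow> ('a, 'b, 'm) module_scheme \<Rightarrow> ('a, 'c, 'n) module_scheme \<Rightarrow> ('b \<times> 'c \<Rightarrow>\<^sub>0 int) set"
  where "tensor_kernel R M N = generate (tensor_free M N) (tensor_relations R M N)"

text \<open>Only the underlying abelian group of the tensor product is constructed: whether an induced
  map is injective does not depend on the scalar multiplication.\<close>

definition tensor_product ::
  "('a, 'r) ring_scheme \<Rightarrow> ('a, 'b, 'm) module_scheme \<Rightarrow> ('a, 'c, 'n) module_scheme
    \<Rightarrow> ('b \<times> 'c \<Rightarrow>\<^sub>0 int) set monoid"
  where "tensor_product R M N = tensor_free M N Mod tensor_kernel R M N"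

definition tensor_free_map :: "('c \<Rightarrow> 'd) \<Rightarrow> ('b \<times> 'c \<Rightarrow>\<^sub>0 int) \<Rightarrow> ('b \<times> 'd \<Rightarrow>\<^sub>0 int)"
  where "tensor_free_map f = frag_extend (\<lambda>(x, y). frag_of (x, f y))"

text \<open>The map \<open>id \<otimes> f\<close> on cosets, for linear \<open>f\<close>; see \<open>tensor_map_coset\<close> below.\<close>

definition tensor_map ::
  "('a, 'r) ring_scheme \<Rightarrow> ('a, 'b, 'm) module_scheme \<Rightarrow> ('a, 'd, 'k) module_scheme
    \<Rightarrow> ('c \<Rightarrow> 'd) \<Rightarrow> ('b \<times> 'c \<Rightarrow>\<^sub>0 int) set \<Rightarrow> ('b \<times> 'd \<Rightarrow>\<^sub>0 int) set"
  where "tensor_map R M N' f C =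
    tensor_kernel R M N' <#>\<^bsub>tensor_free M N'\<^esub> (tensor_free_map f ` C)"


section \<open>Flat modules\<close>

text \<open>A definition cannot quantify over types, so \<open>flat\<close> tests against modules with carrier in
  \<open>'a list set\<close>, where \<open>'a\<close> is the type of the scalars. Every finitely generated module has an
  isomorphic copy of that type (an element corresponds to the set of its coefficient lists), and
  the theorem \<open>flat_imp_inj_tensor_map\<close> below shows that injectivity is preserved for
  test modules of arbitrary types.\<close>

definition flat :: "('a, 'r) ring_scheme \<Rightarrow> ('a, 'b, 'm) module_scheme \<Rightarrow> bool"
  where "flat R M \<longleftrightarrow> module R M \<and>
    (\<forall>(N :: ('a, 'a list set) module) (N' :: ('a, 'a list set) module) f.
       module R N \<and> module R N' \<and> f \<in> module_hom R N N' \<and> inj_on f (carrier N) \<longrightarrow>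
       inj_on (tensor_map R M N' f) (carrier (tensor_product R M N)))"

lemma keys_frag_diffs:
  assumes "p \<in> S" "q \<in> S"
  shows "Poly_Mapping.keys (frag_of p - frag_of q) \<subseteq> S"
    and "s \<in> S \<Longrightarrow> Poly_Mapping.keys (frag_of p - frag_of q - frag_of s) \<subseteq> S"
proof -
  show 1: "Poly_Mapping.keys (frag_of p - frag_of q) \<subseteq> S"
    using keys_diff[of "frag_of p" "frag_of q"] assms by auto
  show "Poly_Mapping.keys (frag_of p - frag_of q - frag_of s) \<subseteq> S" if "s \<in> S"
    using keys_diff[of "frag_of p - frag_of q" "frag_of s"] that 1 by auto
qed

lemma tensor_relations_subset:
  assumes "module R M" "module R N"
  shows "tensor_relations R M N \<subseteq> carrier (tensor_free M N)"
proof -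
  interpret M: module R M by fact
  interpret N: module R N by fact
  show ?thesis
  proof
    fix z assume "z \<in> tensor_relations R M N"
    then have "Poly_Mapping.keys z \<subseteq> carrier M \<times> carrier N"
      unfolding tensor_relations_def
      by (elim UnE CollectE exE conjE) (simp only:, intro keys_frag_diffs; simp)+
    then show "z \<in> carrier (tensor_free M N)" by simp
  qed
qed

lemma tensor_kernel_subgroup:
  assumes "module R M" "module R N"
  shows "subgroup (tensor_kernel R M N) (tensor_free M N)"
  unfolding tensor_kernel_def
  by (rule group.generate_is_subgroup[OF group_free_Abelian_group tensor_relations_subset[OF assms]])

lemma tensor_kernel_normal:
  assumes "module R M" "module R N"
  shows "tensor_kernel R M N \<lhd> tensor_free M N"
  by (rule comm_group.subgroup_imp_normal[OF abelian_free_Abelian_group tensor_kernel_subgroup[OF assms]])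

lemma tensor_kernel_keys:
  assumes "module R M" "module R N" "z \<in> tensor_kernel R M N"
  shows "Poly_Mapping.keys z \<subseteq> carrier M \<times> carrier N"
  using subsetD[OF subgroup.subset[OF tensor_kernel_subgroup[OF assms(1,2)]] assms(3)] by simp

lemma tensor_kernel_zero: "0 \<in> tensor_kernel R M N"
  using generate.one[of "tensor_free M N" "tensor_relations R M N"] by (simp add: tensor_kernel_def)

lemma tensor_kernel_diff:
  assumes "module R M" "module R N" "z \<in> tensor_kernel R M N" "w \<in> tensor_kernel R M N"
  shows "z - w \<in> tensor_kernel R M N"
proof -
  have "inv\<^bsub>tensor_free M N\<^esub> w \<in> tensor_kernel R M N"
    using subgroup.m_inv_closed[OF tensor_kernel_subgroup[OF assms(1,2)] assms(4)] .
  then have "- w \<in> tensor_kernel R M N"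
    using tensor_kernel_keys[OF assms(1,2,4)] by simp
  from subgroup.m_closed[OF tensor_kernel_subgroup[OF assms(1,2)] assms(3) this]
  show ?thesis by simp
qed

lemma tensor_kernel_rel: "z \<in> tensor_relations R M N \<Longrightarrow> z \<in> tensor_kernel R M N"
  by (simp add: tensor_kernel_def generate.incl)

lemma tensor_kernel_induct [consumes 3, case_names zero rel diff]:
  assumes "module R M" "module R N" "z \<in> tensor_kernel R M N"
    and zero: "P 0"
    and rel: "\<And>z. z \<in> tensor_relations R M N \<Longrightarrow> P z"
    and diff: "\<And>z w. P z \<Longrightarrow> P w \<Longrightarrow> P (z - w)"
  shows "P z"
  using assms(3) unfolding tensor_kernel_def
proof (induction rule: generate.induct)
  case one
  then show ?case by (simp add: zero)
next
  case (incl h)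
  then show ?case by (rule rel)
next
  case (inv h)
  then have "Poly_Mapping.keys h \<subseteq> carrier M \<times> carrier N"
    using subsetD[OF tensor_relations_subset[OF assms(1,2)]] by fastforce
  then show ?case using diff[OF zero rel[OF inv]] by simp
next
  case (eng h1 h2)
  then show ?case using diff[OF eng.IH(1) diff[OF zero eng.IH(2)]] by simp
qed

lemma tensor_free_map_zero: "tensor_free_map f 0 = 0"
  by (simp add: tensor_free_map_def)

lemma tensor_free_map_diff: "tensor_free_map f (z - w) = tensor_free_map f z - tensor_free_map f w"
  by (simp add: tensor_free_map_def frag_extend_diff)

lemma tensor_free_map_add: "tensor_free_map f (z + w) = tensor_free_map f z + tensor_free_map f w"
  by (simp add: tensor_free_map_def frag_extend_add)

lemma tensor_free_map_of: "tensor_free_map f (frag_of (x, y)) = frag_of (x, f y)"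
  by (simp add: tensor_free_map_def)

lemmas tensor_free_map_simps =
  tensor_free_map_zero tensor_free_map_diff tensor_free_map_add tensor_free_map_of

lemma keys_tensor_free_map:
  assumes "Poly_Mapping.keys z \<subseteq> A \<times> B" "f ` B \<subseteq> C"
  shows "Poly_Mapping.keys (tensor_free_map f z) \<subseteq> A \<times> C"
  using keys_frag_extend[of "\<lambda>(x, y). frag_of (x, f y)" z] assms
  unfolding tensor_free_map_def by fastforce

lemma tensor_free_map_comp:
  "tensor_free_map f (tensor_free_map g z) = tensor_free_map (\<lambda>y. f (g y)) z"
  using subset_UNIV[of "Poly_Mapping.keys z"]
proof (induction z rule: frag_induction)
  case (one x)
  then show ?case by (cases x) (simp add: tensor_free_map_simps)
qed (simp_all add: tensor_free_map_simps)

lemma tensor_free_map_id_on: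
  assumes "Poly_Mapping.keys z \<subseteq> A \<times> B" "\<And>y. y \<in> B \<Longrightarrow> f y = y"
  shows "tensor_free_map f z = z"
  using assms(1)
proof (induction z rule: frag_induction)
  case (one x)
  then show ?case by (cases x) (auto simp: tensor_free_map_simps assms(2))
qed (simp_all add: tensor_free_map_simps)

lemma tensor_kernel_map:
  assumes "module R M" "module R N" "module R N'" "f \<in> module_hom R N N'" "z \<in> tensor_kernel R M N"
  shows "tensor_free_map f z \<in> tensor_kernel R M N'"
  using assms(1,2,5)
proof (induction rule: tensor_kernel_induct)
  case zero
  then show ?case by (simp add: tensor_free_map_simps tensor_kernel_zero)
next
  case (rel z)
  have fc: "f y \<in> carrier N'" if "y \<in> carrier N" for y
    using assms(4) that by (auto simp: module_hom_def)
  have fa: "f (x \<oplus>\<^bsub>N\<^esub> y) = f x \<oplus>\<^bsub>N'\<^esub> f y" if "x \<in> carrier N" "y \<in> carrier N" for x y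
    using assms(4) that by (auto simp: module_hom_def)
  have fs: "f (r \<odot>\<^bsub>N\<^esub> y) = r \<odot>\<^bsub>N'\<^esub> f y" if "r \<in> carrier R" "y \<in> carrier N" for r y
    using assms(4) that by (auto simp: module_hom_def)
  from rel have "tensor_free_map f z \<in> tensor_relations R M N'"
    unfolding tensor_relations_def using fc
    by (elim UnE CollectE exE conjE) (simp_all add: tensor_free_map_simps fa fs; blast)+
  then show ?case by (rule tensor_kernel_rel)
next
  case (diff z w)
  then show ?case by (simp add: tensor_free_map_simps tensor_kernel_diff assms)
qed

lemma tensor_map_coset:
  assumes "module R M" "module R N" "module R N'" "f \<in> module_hom R N N'"
    and "Poly_Mapping.keys z \<subseteq> carrier M \<times> carrier N"
  shows "tensor_map R M N' f (tensor_kernel R M N #>\<^bsub>tensor_free M N\<^esub> z) =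
    tensor_kernel R M N' #>\<^bsub>tensor_free M N'\<^esub> tensor_free_map f z" (is "?L = ?R")
proof
  have f: "f ` carrier N \<subseteq> carrier N'" using assms(4) by (auto simp: module_hom_def)
  have add: "v + w \<in> tensor_kernel R M N'"
    if "v \<in> tensor_kernel R M N'" "w \<in> tensor_kernel R M N'" for v w
    using subgroup.m_closed[OF tensor_kernel_subgroup[OF assms(1,3)] that] by simp
  show "?L \<subseteq> ?R"
  proof
    fix u assume "u \<in> ?L"
    then obtain k k' where k: "k \<in> tensor_kernel R M N'" "k' \<in> tensor_kernel R M N"
      and u: "u = k + tensor_free_map f (k' + z)"
      by (auto simp: tensor_map_def set_mult_def r_coset_def)
    have "k + tensor_free_map f k' \<in> tensor_kernel R M N'"
      using add k tensor_kernel_map[OF assms(1-4)] by blast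
    moreover have "u = (k + tensor_free_map f k') + tensor_free_map f z"
      by (simp add: u tensor_free_map_simps)
    ultimately show "u \<in> ?R" by (auto simp: r_coset_def)
  qed
  show "?R \<subseteq> ?L"
  proof
    fix u assume "u \<in> ?R"
    then obtain k where k: "k \<in> tensor_kernel R M N'" and u: "u = k + tensor_free_map f z"
      by (auto simp: r_coset_def)
    have "z \<in> tensor_kernel R M N #>\<^bsub>tensor_free M N\<^esub> z"
      using tensor_kernel_zero[of R M N] by (force simp: r_coset_def)
    then show "u \<in> ?L" using k u by (auto simp: tensor_map_def set_mult_def)
  qed
qed

lemma tensor_coset_eq_iff:
  assumes "module R M" "module R N"
    and "Poly_Mapping.keys z \<subseteq> carrier M \<times> carrier N" "Poly_Mapping.keys w \<subseteq> carrier M \<times> carrier N"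
  shows "tensor_kernel R M N #>\<^bsub>tensor_free M N\<^esub> z = tensor_kernel R M N #>\<^bsub>tensor_free M N\<^esub> w
    \<longleftrightarrow> z - w \<in> tensor_kernel R M N" (is "?L = ?R \<longleftrightarrow> _")
proof
  assume eq: "?L = ?R"
  have "z \<in> ?L" using tensor_kernel_zero[of R M N] by (force simp: r_coset_def)
  with eq have "z \<in> ?R" by simp
  then obtain k where "k \<in> tensor_kernel R M N" "z = k + w" by (auto simp: r_coset_def)
  then show "z - w \<in> tensor_kernel R M N" by simp
next
  assume d: "z - w \<in> tensor_kernel R M N"
  have "z = (z - w) \<otimes>\<^bsub>tensor_free M N\<^esub> w" by simp
  then have "z \<in> ?R" using d unfolding r_coset_def by blast
  from group.repr_independence[OF group_free_Abelian_group this _ tensor_kernel_subgroup[OF assms(1,2)]]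
  show "?L = ?R" using assms(4) by simp
qed

lemma inj_on_tensor_map_iff:
  assumes "module R M" "module R N" "module R N'" "f \<in> module_hom R N N'"
  shows "inj_on (tensor_map R M N' f) (carrier (tensor_product R M N)) \<longleftrightarrow>
    (\<forall>z. Poly_Mapping.keys z \<subseteq> carrier M \<times> carrier N \<longrightarrow>
       tensor_free_map f z \<in> tensor_kernel R M N' \<longrightarrow> z \<in> tensor_kernel R M N)" (is "?I \<longleftrightarrow> ?K")
proof -
  have f: "f ` carrier N \<subseteq> carrier N'" using assms(4) by (auto simp: module_hom_def)
  note keys = keys_tensor_free_map[OF _ f]
  have car: "carrier (tensor_product R M N) =
    {tensor_kernel R M N #>\<^bsub>tensor_free M N\<^esub> z | z. Poly_Mapping.keys z \<subseteq> carrier M \<times> carrier N}"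
    by (auto simp: tensor_product_def FactGroup_def RCOSETS_def)
  have keq: "tensor_map R M N' f (tensor_kernel R M N #>\<^bsub>tensor_free M N\<^esub> z) =
      tensor_map R M N' f (tensor_kernel R M N #>\<^bsub>tensor_free M N\<^esub> w) \<longleftrightarrow>
      tensor_free_map f (z - w) \<in> tensor_kernel R M N'"
    if "Poly_Mapping.keys z \<subseteq> carrier M \<times> carrier N" "Poly_Mapping.keys w \<subseteq> carrier M \<times> carrier N" for z w
    using that by (simp add: tensor_map_coset[OF assms] tensor_coset_eq_iff[OF assms(1,3)] keys
        tensor_free_map_simps)
  show ?thesis
  proof
    assume I: ?I
    show ?K
    proof (intro allI impI)
      fix z assume z: "Poly_Mapping.keys z \<subseteq> carrier M \<times> carrier N"
        "tensor_free_map f z \<in> tensor_kernel R M N'"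
      have 0: "Poly_Mapping.keys 0 \<subseteq> carrier M \<times> carrier N" by simp
      have "tensor_kernel R M N #>\<^bsub>tensor_free M N\<^esub> z = tensor_kernel R M N #>\<^bsub>tensor_free M N\<^esub> 0"
      proof (rule inj_onD[OF I])
        show "tensor_map R M N' f (tensor_kernel R M N #>\<^bsub>tensor_free M N\<^esub> z) =
          tensor_map R M N' f (tensor_kernel R M N #>\<^bsub>tensor_free M N\<^esub> 0)"
          using z(2) keq[OF z(1) 0] by simp
      qed (use z(1) 0 in \<open>unfold car, blast+\<close>)
      then show "z \<in> tensor_kernel R M N"
        using tensor_coset_eq_iff[OF assms(1,2) z(1) 0] by simp
    qed
  next
    assume K: ?K
    show ?I
    proof (rule inj_onI)
      fix C D assume "C \<in> carrier (tensor_product R M N)" "D \<in> carrier (tensor_product R M N)"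
        and eq: "tensor_map R M N' f C = tensor_map R M N' f D"
      then obtain z w where zw: "Poly_Mapping.keys z \<subseteq> carrier M \<times> carrier N"
        "Poly_Mapping.keys w \<subseteq> carrier M \<times> carrier N"
        and CD: "C = tensor_kernel R M N #>\<^bsub>tensor_free M N\<^esub> z"
          "D = tensor_kernel R M N #>\<^bsub>tensor_free M N\<^esub> w"
        by (auto simp: car)
      have "tensor_free_map f (z - w) \<in> tensor_kernel R M N'"
        using eq keq[OF zw] by (simp add: CD)
      moreover have "Poly_Mapping.keys (z - w) \<subseteq> carrier M \<times> carrier N"
        using keys_diff[of z w] zw by blast
      ultimately show "C = D"
        using K tensor_coset_eq_iff[OF assms(1,2) zw] by (simp add: CD)
    qed
  qed
qed

lemma tensor_kernel_finitely_supported: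
  assumes "module R M" "module R N" "z \<in> tensor_kernel R M N"
  shows "\<exists>A. finite A \<and> A \<subseteq> carrier N \<and>
    (\<forall>P. A \<subseteq> P \<longrightarrow> submodule P R N \<longrightarrow> z \<in> tensor_kernel R M (N\<lparr>carrier := P\<rparr>))"
  using assms
proof (induction rule: tensor_kernel_induct)
  case zero
  then show ?case by (auto intro: exI[of _ "{}"] tensor_kernel_zero)
next
  case (rel z)
  then consider
    (1) x x' y where "x \<in> carrier M" "x' \<in> carrier M" "y \<in> carrier N"
      "z = frag_of (x \<oplus>\<^bsub>M\<^esub> x', y) - frag_of (x, y) - frag_of (x', y)"
  | (2) x y y' where "x \<in> carrier M" "y \<in> carrier N" "y' \<in> carrier N"
      "z = frag_of (x, y \<oplus>\<^bsub>N\<^esub> y') - frag_of (x, y) - frag_of (x, y')"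
  | (3) r x y where "r \<in> carrier R" "x \<in> carrier M" "y \<in> carrier N"
      "z = frag_of (r \<odot>\<^bsub>M\<^esub> x, y) - frag_of (x, r \<odot>\<^bsub>N\<^esub> y)"
    unfolding tensor_relations_def by blast
  then show ?case
  proof cases
    case 1
    then have "z \<in> tensor_relations R M (N\<lparr>carrier := P\<rparr>)" if "{y} \<subseteq> P" for P
      using that unfolding tensor_relations_def by auto
    with 1 show ?thesis by (intro exI[of _ "{y}"]) (auto intro: tensor_kernel_rel)
  next
    case 2
    then have "z \<in> tensor_relations R M (N\<lparr>carrier := P\<rparr>)" if "{y, y'} \<subseteq> P" for P
      using that unfolding tensor_relations_def by auto
    with 2 show ?thesis by (intro exI[of _ "{y, y'}"]) (auto intro: tensor_kernel_rel)
  next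
    case 3
    then have "z \<in> tensor_relations R M (N\<lparr>carrier := P\<rparr>)" if "{y} \<subseteq> P" for P
      using that unfolding tensor_relations_def by auto
    with 3 show ?thesis by (intro exI[of _ "{y}"]) (auto intro: tensor_kernel_rel)
  qed
next
  case (diff z w)
  then obtain A B where "finite A" "A \<subseteq> carrier N" "finite B" "B \<subseteq> carrier N"
    and A: "\<And>P. A \<subseteq> P \<Longrightarrow> submodule P R N \<Longrightarrow> z \<in> tensor_kernel R M (N\<lparr>carrier := P\<rparr>)"
    and B: "\<And>P. B \<subseteq> P \<Longrightarrow> submodule P R N \<Longrightarrow> w \<in> tensor_kernel R M (N\<lparr>carrier := P\<rparr>)"
    by meson
  moreover have "z - w \<in> tensor_kernel R M (N\<lparr>carrier := P\<rparr>)"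
    if "A \<union> B \<subseteq> P" "submodule P R N" for P
    using that A B
    by (intro tensor_kernel_diff assms(1) submodule.submodule_is_module assms(2)) auto
  ultimately show ?case by (intro exI[of _ "A \<union> B"]) auto
qed

lemma finite_subset_submodule:
  fixes N :: "('a, 'b, 'm) module_scheme"
  assumes "module R N" "finite A" "A \<subseteq> carrier N"
  shows "\<exists>P (e :: 'b \<Rightarrow> 'a list set). submodule P R N \<and> A \<subseteq> P \<and> inj_on e P"
proof -
  interpret N: module R N by fact
  from assms(2,3) have "\<exists>P (s :: 'a list \<Rightarrow> 'b). submodule P R N \<and> A \<subseteq> P \<and> P \<subseteq> range s"
  proof (induction A rule: finite_induct)
    case empty
    have "submodule {\<zero>\<^bsub>N\<^esub>} R N"
      by (rule N.submoduleI) (auto simp: N.smult_r_null)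
    then show ?case
      by (intro exI[of _ "{\<zero>\<^bsub>N\<^esub>}"] exI[of _ "\<lambda>_. \<zero>\<^bsub>N\<^esub>"]) auto
  next
    case (insert a A)
    then obtain P and s :: "'a list \<Rightarrow> 'b" where P: "submodule P R N" "A \<subseteq> P" "P \<subseteq> range s" by auto
    note PE = N.submoduleE[OF P(1)]
    have a: "a \<in> carrier N" using insert by auto
    define P' where "P' = {r \<odot>\<^bsub>N\<^esub> a \<oplus>\<^bsub>N\<^esub> p | r p. r \<in> carrier R \<and> p \<in> P}"
    have P'I: "x \<in> P'" if "x = r \<odot>\<^bsub>N\<^esub> a \<oplus>\<^bsub>N\<^esub> p" "r \<in> carrier R" "p \<in> P" for x r p
      using that by (auto simp: P'_def)
    have Pc: "p \<in> carrier N" if "p \<in> P" for p using PE(1) that by auto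
    have z: "\<zero>\<^bsub>N\<^esub> \<in> P"
      using subgroup.one_closed[OF submodule.axioms(1)[OF P(1)]] by simp
    have "submodule P' R N"
    proof (rule N.submoduleI)
      show "P' \<subseteq> carrier N" using a Pc by (auto simp: P'_def)
      show "\<zero>\<^bsub>N\<^esub> \<in> P'"
        by (rule P'I[of _ "\<zero>\<^bsub>R\<^esub>" "\<zero>\<^bsub>N\<^esub>"]) (use a z in auto)
    next
      fix x assume "x \<in> P'"
      then obtain r p where x: "x = r \<odot>\<^bsub>N\<^esub> a \<oplus>\<^bsub>N\<^esub> p" "r \<in> carrier R" "p \<in> P" by (auto simp: P'_def)
      show "\<ominus>\<^bsub>N\<^esub> x \<in> P'"
        by (rule P'I[of _ "\<ominus>\<^bsub>R\<^esub> r" "\<ominus>\<^bsub>N\<^esub> p"])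
          (use x a PE(3) Pc in \<open>auto simp: N.smult_l_minus N.minus_add\<close>)
    next
      fix x y assume "x \<in> P'" "y \<in> P'"
      then obtain r p r' p' where x: "x = r \<odot>\<^bsub>N\<^esub> a \<oplus>\<^bsub>N\<^esub> p" "r \<in> carrier R" "p \<in> P"
        "y = r' \<odot>\<^bsub>N\<^esub> a \<oplus>\<^bsub>N\<^esub> p'" "r' \<in> carrier R" "p' \<in> P" by (auto simp: P'_def)
      show "x \<oplus>\<^bsub>N\<^esub> y \<in> P'"
        by (rule P'I[of _ "r \<oplus>\<^bsub>R\<^esub> r'" "p \<oplus>\<^bsub>N\<^esub> p'"])
          (use x a PE(5) Pc in \<open>auto simp: N.smult_l_distr N.M.a_ac\<close>)
    next
      fix t x assume t: "t \<in> carrier R" and "x \<in> P'"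
      then obtain r p where x: "x = r \<odot>\<^bsub>N\<^esub> a \<oplus>\<^bsub>N\<^esub> p" "r \<in> carrier R" "p \<in> P" by (auto simp: P'_def)
      show "t \<odot>\<^bsub>N\<^esub> x \<in> P'"
        by (rule P'I[of _ "t \<otimes>\<^bsub>R\<^esub> r" "t \<odot>\<^bsub>N\<^esub> p"])
          (use x t a PE(4) Pc in \<open>auto simp: N.smult_r_distr N.smult_assoc1\<close>)
    qed
    moreover have "a \<in> P'" by (rule P'I[of _ "\<one>\<^bsub>R\<^esub>" "\<zero>\<^bsub>N\<^esub>"]) (use a z in auto)
    moreover have "A \<subseteq> P'"
    proof
      fix x assume "x \<in> A"
      then have "x \<in> P" using P by auto
      then show "x \<in> P'" by (intro P'I[of _ "\<zero>\<^bsub>R\<^esub>" x]) (use a Pc in auto)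
    qed
    moreover have "P' \<subseteq> range (\<lambda>l. hd l \<odot>\<^bsub>N\<^esub> a \<oplus>\<^bsub>N\<^esub> s (tl l))"
    proof
      fix x assume "x \<in> P'"
      then obtain r p where x: "x = r \<odot>\<^bsub>N\<^esub> a \<oplus>\<^bsub>N\<^esub> p" "p \<in> P" by (auto simp: P'_def)
      then obtain l where "p = s l" using P(3) by auto
      then show "x \<in> range (\<lambda>l. hd l \<odot>\<^bsub>N\<^esub> a \<oplus>\<^bsub>N\<^esub> s (tl l))"
        using x by (intro image_eqI[of _ _ "r # l"]) auto
    qed
    ultimately show ?case by (intro exI[of _ P'] exI) auto
  qed
  then obtain P and s :: "'a list \<Rightarrow> 'b" where P: "submodule P R N" "A \<subseteq> P" "P \<subseteq> range s" by auto
  have "inj_on (\<lambda>p. {l. s l = p}) P"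
    using P(3) by (intro inj_onI) blast
  with P show ?thesis by blast
qed

text \<open>Transport of structure along an injection.\<close>

definition transport_module ::
  "('b \<Rightarrow> 'c) \<Rightarrow> ('a, 'b, 'm) module_scheme \<Rightarrow> 'b set \<Rightarrow> ('a, 'c) module"
  where "transport_module e N P =
    \<lparr>carrier = e ` P, monoid.mult = (\<lambda>x y. e (inv_into P e x \<otimes>\<^bsub>N\<^esub> inv_into P e y)), one = e \<one>\<^bsub>N\<^esub>,
     ring.zero = e \<zero>\<^bsub>N\<^esub>, ring.add = (\<lambda>x y. e (inv_into P e x \<oplus>\<^bsub>N\<^esub> inv_into P e y)),
     smult = (\<lambda>r x. e (r \<odot>\<^bsub>N\<^esub> inv_into P e x))\<rparr>"

lemma transport_module:
  fixes N :: "('a, 'b, 'm) module_scheme"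
  assumes "module R N" "submodule P R N" "inj_on e P"
  shows "module R (transport_module e N P)"
    and "e \<in> module_hom R (N\<lparr>carrier := P\<rparr>) (transport_module e N P)"
    and "inv_into P e \<in> module_hom R (transport_module e N P) (N\<lparr>carrier := P\<rparr>)"
proof -
  interpret N: module R N by fact
  note PE = N.submoduleE[OF assms(2)]
  have Pc: "p \<in> carrier N" if "p \<in> P" for p using PE(1) that by auto
  have z: "\<zero>\<^bsub>N\<^esub> \<in> P"
    using subgroup.one_closed[OF submodule.axioms(1)[OF assms(2)]] by simp
  have [simp]: "inv_into P e (e x) = x" if "x \<in> P" for x using assms(3) that by simp
  show "module R (transport_module e N P)"
  proof (rule moduleI)
    show "cring R" by (rule N.R.cring_axioms)
    show "abelian_group (transport_module e N P)"
    proof (rule abelian_groupI)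
      fix x assume "x \<in> carrier (transport_module e N P)"
      then obtain p where p: "x = e p" "p \<in> P" by (auto simp: transport_module_def)
      then have "e (\<ominus>\<^bsub>N\<^esub> p) \<oplus>\<^bsub>transport_module e N P\<^esub> x = \<zero>\<^bsub>transport_module e N P\<^esub>"
        using PE(3) Pc by (auto simp: transport_module_def N.M.l_neg)
      then show "\<exists>y\<in>carrier (transport_module e N P). y \<oplus>\<^bsub>transport_module e N P\<^esub> x = \<zero>\<^bsub>transport_module e N P\<^esub>"
        using p PE(3) by (intro bexI[of _ "e (\<ominus>\<^bsub>N\<^esub> p)"]) (auto simp: transport_module_def)
    qed (use z PE Pc in \<open>auto simp: transport_module_def N.M.a_ac\<close>)
  qed (use z PE Pc in \<open>auto simp: transport_module_def N.smult_l_distr N.smult_r_distr N.smult_assoc1\<close>)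
  show "e \<in> module_hom R (N\<lparr>carrier := P\<rparr>) (transport_module e N P)"
    by (auto simp: module_hom_def transport_module_def)
  show "inv_into P e \<in> module_hom R (transport_module e N P) (N\<lparr>carrier := P\<rparr>)"
    using PE by (auto simp: module_hom_def transport_module_def)
qed

theorem flat_imp_inj_tensor_map:
  fixes R :: "('a, 'r) ring_scheme" and M :: "('a, 'b, 'm) module_scheme"
    and N :: "('a, 'c, 'n) module_scheme" and N' :: "('a, 'd, 'k) module_scheme"
  assumes "flat R M" "module R N" "module R N'" "f \<in> module_hom R N N'" "inj_on f (carrier N)"
  shows "inj_on (tensor_map R M N' f) (carrier (tensor_product R M N))"
proof -
  have M: "module R M" using assms(1) by (simp add: flat_def)
  interpret N: module R N by fact
  interpret N': module R N' by fact
  have fc: "f y \<in> carrier N'" if "y \<in> carrier N" for y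
    using assms(4) that by (auto simp: module_hom_def)
  have fa: "f (x \<oplus>\<^bsub>N\<^esub> y) = f x \<oplus>\<^bsub>N'\<^esub> f y" if "x \<in> carrier N" "y \<in> carrier N" for x y
    using assms(4) that by (auto simp: module_hom_def)
  have fs: "f (r \<odot>\<^bsub>N\<^esub> y) = r \<odot>\<^bsub>N'\<^esub> f y" if "r \<in> carrier R" "y \<in> carrier N" for r y
    using assms(4) that by (auto simp: module_hom_def)
  have f0: "f \<zero>\<^bsub>N\<^esub> = \<zero>\<^bsub>N'\<^esub>"
    using fs[of "\<zero>\<^bsub>R\<^esub>" "\<zero>\<^bsub>N\<^esub>"] fc[OF N.M.zero_closed] by simp
  have fm: "f (\<ominus>\<^bsub>N\<^esub> y) = \<ominus>\<^bsub>N'\<^esub> f y" if "y \<in> carrier N" for y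
    using fs[of "\<ominus>\<^bsub>R\<^esub> \<one>\<^bsub>R\<^esub>" y] that fc[OF that] by (simp add: N.smult_l_minus N'.smult_l_minus)
  show ?thesis
    unfolding inj_on_tensor_map_iff[OF M assms(2-4)]
  proof (intro allI impI)
    fix z assume z: "Poly_Mapping.keys z \<subseteq> carrier M \<times> carrier N"
      and zK: "tensor_free_map f z \<in> tensor_kernel R M N'"
    obtain A where A: "finite A" "A \<subseteq> carrier N'"
      and AK: "\<And>P. A \<subseteq> P \<Longrightarrow> submodule P R N' \<Longrightarrow> tensor_free_map f z \<in> tensor_kernel R M (N'\<lparr>carrier := P\<rparr>)"
      using tensor_kernel_finitely_supported[OF M assms(3) zK] by meson
    define B where "B = A \<union> f ` snd ` Poly_Mapping.keys z"
    have "finite B" "B \<subseteq> carrier N'" using A z fc by (auto simp: B_def)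
    then obtain P and e :: "'d \<Rightarrow> 'a list set" where P: "submodule P R N'" "B \<subseteq> P" "inj_on e P"
      using finite_subset_submodule[OF assms(3)] by meson
    note PE = N'.submoduleE[OF P(1)]
    define Q where "Q = transport_module e N' P"
    note Q = transport_module[OF assms(3) P(1,3), folded Q_def]
    interpret Q: module R Q by (rule Q(1))
    note subm = submodule.submodule_is_module[OF P(1) assms(3)]
    define L where "L = {y \<in> carrier N. f y \<in> P}"
    have "submodule L R N"
    proof (rule N.submoduleI)
      show "\<zero>\<^bsub>N\<^esub> \<in> L"
        using subgroup.one_closed[OF submodule.axioms(1)[OF P(1)]] by (simp add: L_def f0)
    qed (use PE in \<open>auto simp: L_def fa fs fm\<close>)
    note LE = N.submoduleE[OF this]
    define g where "g = (\<lambda>y. e (f y))"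
    have inj: "inj_on g L"
      using assms(5) P(3) by (auto simp: g_def L_def inj_on_def)
    define T where "T = transport_module g N L"
    note T = transport_module[OF assms(2) \<open>submodule L R N\<close> inj, folded T_def]
    have gi: "inv_into P e (g y) = f y" if "y \<in> L" for y
      using that P(3) by (simp add: g_def L_def)
    have gi': "inv_into L g (g y) = y" if "y \<in> L" for y
      using that inj by simp
    have incl: "(\<lambda>y. y) \<in> module_hom R T Q"
      using LE by (auto simp: module_hom_def T_def Q_def transport_module_def gi gi')
        (auto simp: g_def L_def fa fs)
    have "inj_on (tensor_map R M Q (\<lambda>y. y)) (carrier (tensor_product R M T))"
      using assms(1) T(1) Q(1) incl unfolding flat_def by (metis inj_on_id2)
    then have TQ: "w \<in> tensor_kernel R M T"
      if "Poly_Mapping.keys w \<subseteq> carrier M \<times> carrier T" "tensor_free_map (\<lambda>y. y) w \<in> tensor_kernel R M Q" for w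
      using inj_on_tensor_map_iff[OF M T(1) Q(1) incl] that by blast
    have zL: "Poly_Mapping.keys z \<subseteq> carrier M \<times> L"
      using z P(2) by (force simp: B_def L_def)
    define w where "w = tensor_free_map g z"
    have "w = tensor_free_map e (tensor_free_map f z)"
      by (simp add: w_def tensor_free_map_comp g_def)
    moreover have "tensor_free_map f z \<in> tensor_kernel R M (N'\<lparr>carrier := P\<rparr>)"
      using AK P(1,2) by (auto simp: B_def)
    ultimately have "w \<in> tensor_kernel R M Q"
      using tensor_kernel_map[OF M subm Q(1,2)] by simp
    moreover have "Poly_Mapping.keys w \<subseteq> carrier M \<times> carrier T"
      unfolding w_def by (rule keys_tensor_free_map[OF zL]) (simp add: T_def transport_module_def)
    ultimately have "w \<in> tensor_kernel R M T"
      using TQ[of w] tensor_free_map_id_on[of w "carrier M" "carrier T" "\<lambda>y. y"] by simp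
    moreover have "inv_into L g \<in> module_hom R T N"
      using T(3) LE(1) by (auto simp: module_hom_def)
    ultimately have "tensor_free_map (inv_into L g) w \<in> tensor_kernel R M N"
      using tensor_kernel_map[OF M T(1) assms(2)] by simp
    moreover have "tensor_free_map (inv_into L g) w = z"
      unfolding w_def tensor_free_map_comp by (rule tensor_free_map_id_on[OF zL gi'])
    ultimately show "z \<in> tensor_kernel R M N" by simp
  qed
qed


section \<open>PF-rings\<close>

definition ideal_module :: "('a, 'r) ring_scheme \<Rightarrow> 'a set \<Rightarrow> ('a, 'a) module"
  where "ideal_module R J =
    \<lparr>carrier = J, monoid.mult = monoid.mult R, one = \<one>\<^bsub>R\<^esub>, ring.zero = \<zero>\<^bsub>R\<^esub>,
     ring.add = ring.add R, smult = monoid.mult R\<rparr>"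

definition PF_ring :: "('a, 'r) ring_scheme \<Rightarrow> bool"
  where "PF_ring R \<longleftrightarrow> cring R \<and> (\<forall>J. principalideal J R \<longrightarrow> flat R (ideal_module R J))"

lemma module_ideal_module:
  assumes "cring R" "ideal J R"
  shows "module R (ideal_module R J)"
proof -
  interpret cring R by fact
  interpret J: ideal J R by fact
  show ?thesis
  proof (rule moduleI)
    show "abelian_group (ideal_module R J)"
    proof (rule abelian_groupI)
      fix x assume "x \<in> carrier (ideal_module R J)"
      then show "\<exists>y\<in>carrier (ideal_module R J). y \<oplus>\<^bsub>ideal_module R J\<^esub> x = \<zero>\<^bsub>ideal_module R J\<^esub>"
        by (intro bexI[of _ "\<ominus>\<^bsub>R\<^esub> x"]) (auto simp: ideal_module_def l_neg)
    qed (auto simp: ideal_module_def a_ac)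
  qed (auto simp: ideal_module_def l_distr r_distr m_assoc J.I_l_closed is_cring)
qed


section \<open>Localization and pure ideals\<close>

definition fraction :: "('a, 'r) ring_scheme \<Rightarrow> 'a set \<Rightarrow> 'a \<Rightarrow> 'a \<Rightarrow> ('a \<times> 'a) set"
  where "fraction R S r s =
    {(r', s'). r' \<in> carrier R \<and> s' \<in> S \<and>
       (\<exists>t\<in>S. t \<otimes>\<^bsub>R\<^esub> (r \<otimes>\<^bsub>R\<^esub> s' \<ominus>\<^bsub>R\<^esub> r' \<otimes>\<^bsub>R\<^esub> s) = \<zero>\<^bsub>R\<^esub>)}"

definition localization :: "('a, 'r) ring_scheme \<Rightarrow> 'a set \<Rightarrow> ('a \<times> 'a) set ring"
  where "localization R S =
    \<lparr>carrier = {fraction R S r s | r s. r \<in> carrier R \<and> s \<in> S},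
     monoid.mult = (\<lambda>x y. \<Union>(r, s)\<in>x. \<Union>(r', s')\<in>y. fraction R S (r \<otimes>\<^bsub>R\<^esub> r') (s \<otimes>\<^bsub>R\<^esub> s')),
     one = fraction R S \<one>\<^bsub>R\<^esub> \<one>\<^bsub>R\<^esub>,
     ring.zero = fraction R S \<zero>\<^bsub>R\<^esub> \<one>\<^bsub>R\<^esub>,
     ring.add = (\<lambda>x y. \<Union>(r, s)\<in>x. \<Union>(r', s')\<in>y.
       fraction R S (r \<otimes>\<^bsub>R\<^esub> s' \<oplus>\<^bsub>R\<^esub> r' \<otimes>\<^bsub>R\<^esub> s) (s \<otimes>\<^bsub>R\<^esub> s'))\<rparr>"

lemma fraction_eq_iff:
  assumes "cring R" "submonoid S R" "r \<in> carrier R" "s \<in> S" "r' \<in> carrier R" "s' \<in> S"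
  shows "fraction R S r s = fraction R S r' s' \<longleftrightarrow>
    (\<exists>t\<in>S. t \<otimes>\<^bsub>R\<^esub> (r \<otimes>\<^bsub>R\<^esub> s' \<ominus>\<^bsub>R\<^esub> r' \<otimes>\<^bsub>R\<^esub> s) = \<zero>\<^bsub>R\<^esub>)" (is "_ \<longleftrightarrow> ?rel r s r' s'")
proof -
  interpret cring R by fact
  interpret S: submonoid S R by fact
  have Sc: "x \<in> carrier R" if "x \<in> S" for x using S.subset that by auto
  have sym: "?rel c d a b" if r: "?rel a b c d" and c: "a \<in> carrier R" "b \<in> S" "c \<in> carrier R" "d \<in> S" for a b c d
  proof -
    from r obtain t where t: "t \<in> S" "t \<otimes>\<^bsub>R\<^esub> (a \<otimes>\<^bsub>R\<^esub> d \<ominus>\<^bsub>R\<^esub> c \<otimes>\<^bsub>R\<^esub> b) = \<zero>\<^bsub>R\<^esub>" by blast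
    have "t \<otimes>\<^bsub>R\<^esub> (c \<otimes>\<^bsub>R\<^esub> b \<ominus>\<^bsub>R\<^esub> a \<otimes>\<^bsub>R\<^esub> d) = \<ominus>\<^bsub>R\<^esub> (t \<otimes>\<^bsub>R\<^esub> (a \<otimes>\<^bsub>R\<^esub> d \<ominus>\<^bsub>R\<^esub> c \<otimes>\<^bsub>R\<^esub> b))"
      using c t(1) Sc[OF c(2)] Sc[OF c(4)] Sc[OF t(1)] by algebra
    then show ?thesis using t by auto
  qed
  have trans: "?rel a b e f" if r: "?rel a b c d" "?rel c d e f"
    and c: "a \<in> carrier R" "b \<in> S" "c \<in> carrier R" "d \<in> S" "e \<in> carrier R" "f \<in> S" for a b c d e f
  proof -
    from r obtain t u where t: "t \<in> S" "t \<otimes>\<^bsub>R\<^esub> (a \<otimes>\<^bsub>R\<^esub> d \<ominus>\<^bsub>R\<^esub> c \<otimes>\<^bsub>R\<^esub> b) = \<zero>\<^bsub>R\<^esub>"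
      and u: "u \<in> S" "u \<otimes>\<^bsub>R\<^esub> (c \<otimes>\<^bsub>R\<^esub> f \<ominus>\<^bsub>R\<^esub> e \<otimes>\<^bsub>R\<^esub> d) = \<zero>\<^bsub>R\<^esub>" by blast
    note cs = Sc[OF c(2)] Sc[OF c(4)] Sc[OF c(6)] Sc[OF t(1)] Sc[OF u(1)] c(1,3,5)
    have "(t \<otimes>\<^bsub>R\<^esub> u \<otimes>\<^bsub>R\<^esub> d) \<otimes>\<^bsub>R\<^esub> (a \<otimes>\<^bsub>R\<^esub> f \<ominus>\<^bsub>R\<^esub> e \<otimes>\<^bsub>R\<^esub> b) =
      (u \<otimes>\<^bsub>R\<^esub> f) \<otimes>\<^bsub>R\<^esub> (t \<otimes>\<^bsub>R\<^esub> (a \<otimes>\<^bsub>R\<^esub> d \<ominus>\<^bsub>R\<^esub> c \<otimes>\<^bsub>R\<^esub> b)) \<oplus>\<^bsub>R\<^esub>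
      (t \<otimes>\<^bsub>R\<^esub> b) \<otimes>\<^bsub>R\<^esub> (u \<otimes>\<^bsub>R\<^esub> (c \<otimes>\<^bsub>R\<^esub> f \<ominus>\<^bsub>R\<^esub> e \<otimes>\<^bsub>R\<^esub> d))"
      using cs by algebra
    then have "(t \<otimes>\<^bsub>R\<^esub> u \<otimes>\<^bsub>R\<^esub> d) \<otimes>\<^bsub>R\<^esub> (a \<otimes>\<^bsub>R\<^esub> f \<ominus>\<^bsub>R\<^esub> e \<otimes>\<^bsub>R\<^esub> b) = \<zero>\<^bsub>R\<^esub>"
      using cs by (simp add: t(2) u(2))
    then show ?thesis using t(1) u(1) c(4) by blast
  qed
  have refl: "?rel a b a b" if "a \<in> carrier R" "b \<in> S" for a b
    using that Sc[OF that(2)] S.one_closed by (intro bexI[of _ "\<one>\<^bsub>R\<^esub>"]) (auto simp: minus_eq r_neg)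
  show ?thesis
  proof
    assume "fraction R S r s = fraction R S r' s'"
    moreover have "(r', s') \<in> fraction R S r' s'"
      using refl assms(5,6) by (simp add: fraction_def)
    ultimately have "(r', s') \<in> fraction R S r s" by simp
    then show "?rel r s r' s'" by (simp add: fraction_def)
  next
    assume rel: "?rel r s r' s'"
    have "?rel r s a b \<longleftrightarrow> ?rel r' s' a b" if "a \<in> carrier R" "b \<in> S" for a b
      using trans[OF rel _ assms(3-6) that] trans[OF sym[OF rel assms(3-6)] _ assms(5,6,3,4) that] by blast
    then show "fraction R S r s = fraction R S r' s'"
      unfolding fraction_def by blast
  qed
qed

lemma fraction_self:
  assumes "cring R" "submonoid S R" "r \<in> carrier R" "s \<in> S"
  shows "(r, s) \<in> fraction R S r s"
  using fraction_eq_iff[OF assms(1-4) assms(3,4)] assms by (simp add: fraction_def)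

lemma mem_fraction_iff:
  assumes "cring R" "submonoid S R" "r \<in> carrier R" "s \<in> S"
  shows "(a, b) \<in> fraction R S r s \<longleftrightarrow> a \<in> carrier R \<and> b \<in> S \<and> fraction R S a b = fraction R S r s"
  using fraction_eq_iff[OF assms, of a b] by (auto simp: fraction_def)

lemma UN_pair_const:
  assumes "(u, v) \<in> x" "(u', v') \<in> y"
    and eq: "\<And>a b a' b'. (a, b) \<in> x \<Longrightarrow> (a', b') \<in> y \<Longrightarrow> f a b a' b' = c"
  shows "(\<Union>(a, b)\<in>x. \<Union>(a', b')\<in>y. f a b a' b') = c"
proof -
  have "(\<Union>(a, b)\<in>x. \<Union>(a', b')\<in>y. f a b a' b') = (\<Union>(a, b)\<in>x. \<Union>(a', b')\<in>y. c)"
    by (intro SUP_cong refl) (auto simp: eq split_beta)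
  also have "\<dots> = c" using assms(1,2) by auto
  finally show ?thesis .
qed

lemma localization_mult:
  assumes "cring R" "submonoid S R" "r \<in> carrier R" "s \<in> S" "r' \<in> carrier R" "s' \<in> S"
  shows "fraction R S r s \<otimes>\<^bsub>localization R S\<^esub> fraction R S r' s' = fraction R S (r \<otimes>\<^bsub>R\<^esub> r') (s \<otimes>\<^bsub>R\<^esub> s')"
proof -
  interpret cring R by fact
  interpret S: submonoid S R by fact
  have Sc: "x \<in> carrier R" if "x \<in> S" for x using S.subset that by auto
  have eq: "fraction R S (a \<otimes>\<^bsub>R\<^esub> a') (b \<otimes>\<^bsub>R\<^esub> b') = fraction R S (r \<otimes>\<^bsub>R\<^esub> r') (s \<otimes>\<^bsub>R\<^esub> s')"
    if ab: "(a, b) \<in> fraction R S r s" "(a', b') \<in> fraction R S r' s'" for a b a' b'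
  proof -
    from ab obtain t u where c: "a \<in> carrier R" "b \<in> S" "a' \<in> carrier R" "b' \<in> S"
      and t: "t \<in> S" "t \<otimes>\<^bsub>R\<^esub> (r \<otimes>\<^bsub>R\<^esub> b \<ominus>\<^bsub>R\<^esub> a \<otimes>\<^bsub>R\<^esub> s) = \<zero>\<^bsub>R\<^esub>"
      and u: "u \<in> S" "u \<otimes>\<^bsub>R\<^esub> (r' \<otimes>\<^bsub>R\<^esub> b' \<ominus>\<^bsub>R\<^esub> a' \<otimes>\<^bsub>R\<^esub> s') = \<zero>\<^bsub>R\<^esub>"
      by (auto simp: fraction_def)
    note cs = c(1,3) Sc[OF c(2)] Sc[OF c(4)] Sc[OF t(1)] Sc[OF u(1)] assms(3,5) Sc[OF assms(4)] Sc[OF assms(6)]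
    have "(t \<otimes>\<^bsub>R\<^esub> u) \<otimes>\<^bsub>R\<^esub> ((r \<otimes>\<^bsub>R\<^esub> r') \<otimes>\<^bsub>R\<^esub> (b \<otimes>\<^bsub>R\<^esub> b') \<ominus>\<^bsub>R\<^esub> (a \<otimes>\<^bsub>R\<^esub> a') \<otimes>\<^bsub>R\<^esub> (s \<otimes>\<^bsub>R\<^esub> s')) =
      (u \<otimes>\<^bsub>R\<^esub> r' \<otimes>\<^bsub>R\<^esub> b') \<otimes>\<^bsub>R\<^esub> (t \<otimes>\<^bsub>R\<^esub> (r \<otimes>\<^bsub>R\<^esub> b \<ominus>\<^bsub>R\<^esub> a \<otimes>\<^bsub>R\<^esub> s)) \<oplus>\<^bsub>R\<^esub>
      (t \<otimes>\<^bsub>R\<^esub> a \<otimes>\<^bsub>R\<^esub> s) \<otimes>\<^bsub>R\<^esub> (u \<otimes>\<^bsub>R\<^esub> (r' \<otimes>\<^bsub>R\<^esub> b' \<ominus>\<^bsub>R\<^esub> a' \<otimes>\<^bsub>R\<^esub> s'))"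
      using cs by algebra
    then have z: "(t \<otimes>\<^bsub>R\<^esub> u) \<otimes>\<^bsub>R\<^esub> ((r \<otimes>\<^bsub>R\<^esub> r') \<otimes>\<^bsub>R\<^esub> (b \<otimes>\<^bsub>R\<^esub> b') \<ominus>\<^bsub>R\<^esub> (a \<otimes>\<^bsub>R\<^esub> a') \<otimes>\<^bsub>R\<^esub> (s \<otimes>\<^bsub>R\<^esub> s')) = \<zero>\<^bsub>R\<^esub>"
      using cs by (simp add: t(2) u(2))
    show ?thesis
      by (rule sym, subst fraction_eq_iff[OF assms(1,2)])
        (use z t(1) u(1) c assms(3-6) in blast)+
  qed
  show ?thesis
    unfolding localization_def ring.simps monoid.simps
    by (rule UN_pair_const[OF fraction_self[OF assms(1-4)] fraction_self[OF assms(1,2,5,6)] eq])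
qed

lemma localization_add:
  assumes "cring R" "submonoid S R" "r \<in> carrier R" "s \<in> S" "r' \<in> carrier R" "s' \<in> S"
  shows "fraction R S r s \<oplus>\<^bsub>localization R S\<^esub> fraction R S r' s' =
    fraction R S (r \<otimes>\<^bsub>R\<^esub> s' \<oplus>\<^bsub>R\<^esub> r' \<otimes>\<^bsub>R\<^esub> s) (s \<otimes>\<^bsub>R\<^esub> s')"
proof -
  interpret cring R by fact
  interpret S: submonoid S R by fact
  have Sc: "x \<in> carrier R" if "x \<in> S" for x using S.subset that by auto
  have eq: "fraction R S (a \<otimes>\<^bsub>R\<^esub> b' \<oplus>\<^bsub>R\<^esub> a' \<otimes>\<^bsub>R\<^esub> b) (b \<otimes>\<^bsub>R\<^esub> b') =
      fraction R S (r \<otimes>\<^bsub>R\<^esub> s' \<oplus>\<^bsub>R\<^esub> r' \<otimes>\<^bsub>R\<^esub> s) (s \<otimes>\<^bsub>R\<^esub> s')"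
    if ab: "(a, b) \<in> fraction R S r s" "(a', b') \<in> fraction R S r' s'" for a b a' b'
  proof -
    from ab obtain t u where c: "a \<in> carrier R" "b \<in> S" "a' \<in> carrier R" "b' \<in> S"
      and t: "t \<in> S" "t \<otimes>\<^bsub>R\<^esub> (r \<otimes>\<^bsub>R\<^esub> b \<ominus>\<^bsub>R\<^esub> a \<otimes>\<^bsub>R\<^esub> s) = \<zero>\<^bsub>R\<^esub>"
      and u: "u \<in> S" "u \<otimes>\<^bsub>R\<^esub> (r' \<otimes>\<^bsub>R\<^esub> b' \<ominus>\<^bsub>R\<^esub> a' \<otimes>\<^bsub>R\<^esub> s') = \<zero>\<^bsub>R\<^esub>"
      by (auto simp: fraction_def)
    note cs = c(1,3) Sc[OF c(2)] Sc[OF c(4)] Sc[OF t(1)] Sc[OF u(1)] assms(3,5) Sc[OF assms(4)] Sc[OF assms(6)]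
    have "(t \<otimes>\<^bsub>R\<^esub> u) \<otimes>\<^bsub>R\<^esub> ((r \<otimes>\<^bsub>R\<^esub> s' \<oplus>\<^bsub>R\<^esub> r' \<otimes>\<^bsub>R\<^esub> s) \<otimes>\<^bsub>R\<^esub> (b \<otimes>\<^bsub>R\<^esub> b') \<ominus>\<^bsub>R\<^esub>
        (a \<otimes>\<^bsub>R\<^esub> b' \<oplus>\<^bsub>R\<^esub> a' \<otimes>\<^bsub>R\<^esub> b) \<otimes>\<^bsub>R\<^esub> (s \<otimes>\<^bsub>R\<^esub> s')) =
      (u \<otimes>\<^bsub>R\<^esub> s' \<otimes>\<^bsub>R\<^esub> b') \<otimes>\<^bsub>R\<^esub> (t \<otimes>\<^bsub>R\<^esub> (r \<otimes>\<^bsub>R\<^esub> b \<ominus>\<^bsub>R\<^esub> a \<otimes>\<^bsub>R\<^esub> s)) \<oplus>\<^bsub>R\<^esub>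
      (t \<otimes>\<^bsub>R\<^esub> s \<otimes>\<^bsub>R\<^esub> b) \<otimes>\<^bsub>R\<^esub> (u \<otimes>\<^bsub>R\<^esub> (r' \<otimes>\<^bsub>R\<^esub> b' \<ominus>\<^bsub>R\<^esub> a' \<otimes>\<^bsub>R\<^esub> s'))"
      using cs by algebra
    then have z: "(t \<otimes>\<^bsub>R\<^esub> u) \<otimes>\<^bsub>R\<^esub> ((r \<otimes>\<^bsub>R\<^esub> s' \<oplus>\<^bsub>R\<^esub> r' \<otimes>\<^bsub>R\<^esub> s) \<otimes>\<^bsub>R\<^esub> (b \<otimes>\<^bsub>R\<^esub> b') \<ominus>\<^bsub>R\<^esub>
        (a \<otimes>\<^bsub>R\<^esub> b' \<oplus>\<^bsub>R\<^esub> a' \<otimes>\<^bsub>R\<^esub> b) \<otimes>\<^bsub>R\<^esub> (s \<otimes>\<^bsub>R\<^esub> s')) = \<zero>\<^bsub>R\<^esub>"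
      using cs by (simp add: t(2) u(2))
    show ?thesis
      by (rule sym, subst fraction_eq_iff[OF assms(1,2)])
        (use z t(1) u(1) c assms(3-6) cs in \<open>auto\<close>)
  qed
  show ?thesis
    unfolding localization_def ring.simps monoid.simps
    by (rule UN_pair_const[OF fraction_self[OF assms(1-4)] fraction_self[OF assms(1,2,5,6)] eq])
qed

lemma cring_localization:
  assumes "cring R" "submonoid S R"
  shows "cring (localization R S)"
proof -
  interpret cring R by fact
  interpret S: submonoid S R by fact
  have Sc [simp]: "x \<in> carrier R" if "x \<in> S" for x using S.subset that by auto
  have frI: "fraction R S r s = fraction R S r' s'"
    if "r \<otimes>\<^bsub>R\<^esub> s' = r' \<otimes>\<^bsub>R\<^esub> s" "r \<in> carrier R" "s \<in> S" "r' \<in> carrier R" "s' \<in> S" for r s r' s'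
    using that by (subst fraction_eq_iff[OF assms])
      (auto intro!: bexI[of _ "\<one>\<^bsub>R\<^esub>"] simp: minus_eq r_neg)
  have car: "carrier (localization R S) = {fraction R S r s | r s. r \<in> carrier R \<and> s \<in> S}"
    by (simp add: localization_def)
  have one: "\<one>\<^bsub>localization R S\<^esub> = fraction R S \<one>\<^bsub>R\<^esub> \<one>\<^bsub>R\<^esub>"
    and zero: "\<zero>\<^bsub>localization R S\<^esub> = fraction R S \<zero>\<^bsub>R\<^esub> \<one>\<^bsub>R\<^esub>"
    by (simp_all add: localization_def)
  note ops = localization_mult[OF assms] localization_add[OF assms] one zero
  show ?thesis
  proof (rule cringI)
    show "abelian_group (localization R S)"
    proof (rule abelian_groupI)
      fix x y assume "x \<in> carrier (localization R S)" "y \<in> carrier (localization R S)"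
      then show "x \<oplus>\<^bsub>localization R S\<^esub> y \<in> carrier (localization R S)"
        unfolding car by (clarsimp simp: ops) (metis Sc S.m_closed a_closed m_closed)
    next
      show "\<zero>\<^bsub>localization R S\<^esub> \<in> carrier (localization R S)"
        unfolding car zero using S.one_closed zero_closed by blast
    next
      fix x y z assume "x \<in> carrier (localization R S)" "y \<in> carrier (localization R S)" "z \<in> carrier (localization R S)"
      then show "x \<oplus>\<^bsub>localization R S\<^esub> y \<oplus>\<^bsub>localization R S\<^esub> z = x \<oplus>\<^bsub>localization R S\<^esub> (y \<oplus>\<^bsub>localization R S\<^esub> z)"
        unfolding car by (clarsimp simp: ops) (rule frI; simp add: l_distr r_distr m_ac a_ac l_minus l_neg)
    next
      fix x y assume "x \<in> carrier (localization R S)" "y \<in> carrier (localization R S)"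
      then show "x \<oplus>\<^bsub>localization R S\<^esub> y = y \<oplus>\<^bsub>localization R S\<^esub> x"
        unfolding car by (clarsimp simp: ops) (rule frI; simp add: l_distr r_distr m_ac a_ac l_minus l_neg)
    next
      fix x assume "x \<in> carrier (localization R S)"
      then show "\<zero>\<^bsub>localization R S\<^esub> \<oplus>\<^bsub>localization R S\<^esub> x = x"
        unfolding car by (clarsimp simp: ops)
    next
      fix x assume "x \<in> carrier (localization R S)"
      then obtain r s where x: "x = fraction R S r s" "r \<in> carrier R" "s \<in> S" by (auto simp: car)
      have "fraction R S (\<ominus>\<^bsub>R\<^esub> r) s \<oplus>\<^bsub>localization R S\<^esub> x = \<zero>\<^bsub>localization R S\<^esub>"
        using x by (simp add: ops) (rule frI; simp add: l_minus l_neg)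
      then show "\<exists>y\<in>carrier (localization R S). y \<oplus>\<^bsub>localization R S\<^esub> x = \<zero>\<^bsub>localization R S\<^esub>"
        using x(2,3) by (intro bexI[of _ "fraction R S (\<ominus>\<^bsub>R\<^esub> r) s"]) (auto simp: car)
    qed
    show "comm_monoid (localization R S)"
    proof (rule comm_monoidI)
      fix x y assume "x \<in> carrier (localization R S)" "y \<in> carrier (localization R S)"
      then show "x \<otimes>\<^bsub>localization R S\<^esub> y \<in> carrier (localization R S)"
        unfolding car by (clarsimp simp: ops) (metis S.m_closed m_closed)
    next
      show "\<one>\<^bsub>localization R S\<^esub> \<in> carrier (localization R S)"
        unfolding car one using S.one_closed one_closed by blast
    next
      fix x y z assume "x \<in> carrier (localization R S)" "y \<in> carrier (localization R S)" "z \<in> carrier (localization R S)"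
      then show "x \<otimes>\<^bsub>localization R S\<^esub> y \<otimes>\<^bsub>localization R S\<^esub> z = x \<otimes>\<^bsub>localization R S\<^esub> (y \<otimes>\<^bsub>localization R S\<^esub> z)"
        unfolding car by (clarsimp simp: ops m_assoc)
    next
      fix x y assume "x \<in> carrier (localization R S)" "y \<in> carrier (localization R S)"
      then show "x \<otimes>\<^bsub>localization R S\<^esub> y = y \<otimes>\<^bsub>localization R S\<^esub> x"
        unfolding car by (clarsimp simp: ops m_comm)
    next
      fix x assume "x \<in> carrier (localization R S)"
      then show "\<one>\<^bsub>localization R S\<^esub> \<otimes>\<^bsub>localization R S\<^esub> x = x"
        unfolding car by (clarsimp simp: ops)
    qed
    fix x y z assume "x \<in> carrier (localization R S)" "y \<in> carrier (localization R S)" "z \<in> carrier (localization R S)"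
    then show "(x \<oplus>\<^bsub>localization R S\<^esub> y) \<otimes>\<^bsub>localization R S\<^esub> z =
        x \<otimes>\<^bsub>localization R S\<^esub> z \<oplus>\<^bsub>localization R S\<^esub> y \<otimes>\<^bsub>localization R S\<^esub> z"
      unfolding car by (clarsimp simp: ops) (rule frI; simp add: l_distr r_distr m_ac a_ac l_minus l_neg)
  qed
qed

text \<open>The localization of an ideal, identified with its image under the (injective) map into
  the localization of the ring.\<close>

definition localized_ideal :: "('a, 'r) ring_scheme \<Rightarrow> 'a set \<Rightarrow> 'a set \<Rightarrow> ('a \<times> 'a) set set"
  where "localized_ideal R S I = {fraction R S i s | i s. i \<in> I \<and> s \<in> S}"

definition pure_ideal :: "'a set \<Rightarrow> ('a, 'r) ring_scheme \<Rightarrow> bool"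
  where "pure_ideal I R \<longleftrightarrow> ideal I R \<and>
    (\<forall>m. maximalideal m R \<longrightarrow>
       localized_ideal R (carrier R - m) I \<in>
         {{\<zero>\<^bsub>localization R (carrier R - m)\<^esub>}, carrier (localization R (carrier R - m))})"


section \<open>Amalgamated duplication of a ring along an ideal\<close>

definition amalgamated_duplication :: "('a, 'r) ring_scheme \<Rightarrow> 'a set \<Rightarrow> ('a \<times> 'a) ring"
  where "amalgamated_duplication R I =
    (RDirProd R R)\<lparr>carrier := {(r, r \<oplus>\<^bsub>R\<^esub> i) | r i. r \<in> carrier R \<and> i \<in> I}\<rparr>"

lemma amalgamated_duplication_simps:
  "carrier (amalgamated_duplication R I) = {(r, r \<oplus>\<^bsub>R\<^esub> i) | r i. r \<in> carrier R \<and> i \<in> I}"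
  "p \<oplus>\<^bsub>amalgamated_duplication R I\<^esub> q = (fst p \<oplus>\<^bsub>R\<^esub> fst q, snd p \<oplus>\<^bsub>R\<^esub> snd q)"
  "p \<otimes>\<^bsub>amalgamated_duplication R I\<^esub> q = (fst p \<otimes>\<^bsub>R\<^esub> fst q, snd p \<otimes>\<^bsub>R\<^esub> snd q)"
  "\<zero>\<^bsub>amalgamated_duplication R I\<^esub> = (\<zero>\<^bsub>R\<^esub>, \<zero>\<^bsub>R\<^esub>)"
  "\<one>\<^bsub>amalgamated_duplication R I\<^esub> = (\<one>\<^bsub>R\<^esub>, \<one>\<^bsub>R\<^esub>)"
  by (simp_all add: amalgamated_duplication_def RDirProd_def monoid.defs DirProd_def split_beta)

lemma cring_amalgamated_duplication:
  assumes "cring R" "ideal I R"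
  shows "cring (amalgamated_duplication R I)"
proof -
  interpret cring R by fact
  interpret I: ideal I R by fact
  have Ic: "i \<in> carrier R" if "i \<in> I" for i using I.Icarr that .
  have car: "p \<in> carrier (amalgamated_duplication R I) \<longleftrightarrow>
    fst p \<in> carrier R \<and> snd p \<in> carrier R \<and> snd p \<ominus>\<^bsub>R\<^esub> fst p \<in> I" for p
  proof
    assume "p \<in> carrier (amalgamated_duplication R I)"
    then obtain r i where p: "p = (r, r \<oplus>\<^bsub>R\<^esub> i)" "r \<in> carrier R" "i \<in> I"
      by (auto simp: amalgamated_duplication_simps)
    moreover have "r \<oplus>\<^bsub>R\<^esub> i \<ominus>\<^bsub>R\<^esub> r = i" using p(2) Ic[OF p(3)] by algebra
    ultimately show "fst p \<in> carrier R \<and> snd p \<in> carrier R \<and> snd p \<ominus>\<^bsub>R\<^esub> fst p \<in> I"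
      using Ic by simp
  next
    assume p: "fst p \<in> carrier R \<and> snd p \<in> carrier R \<and> snd p \<ominus>\<^bsub>R\<^esub> fst p \<in> I"
    then have "snd p = fst p \<oplus>\<^bsub>R\<^esub> (snd p \<ominus>\<^bsub>R\<^esub> fst p)" by algebra
    then show "p \<in> carrier (amalgamated_duplication R I)"
      using p by (cases p) (auto simp: amalgamated_duplication_simps)
  qed
  have addI: "(b \<oplus>\<^bsub>R\<^esub> d) \<ominus>\<^bsub>R\<^esub> (a \<oplus>\<^bsub>R\<^esub> c) \<in> I"
    if "a \<in> carrier R" "b \<in> carrier R" "c \<in> carrier R" "d \<in> carrier R" "b \<ominus>\<^bsub>R\<^esub> a \<in> I" "d \<ominus>\<^bsub>R\<^esub> c \<in> I" for a b c d
  proof -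
    have "(b \<oplus>\<^bsub>R\<^esub> d) \<ominus>\<^bsub>R\<^esub> (a \<oplus>\<^bsub>R\<^esub> c) = (b \<ominus>\<^bsub>R\<^esub> a) \<oplus>\<^bsub>R\<^esub> (d \<ominus>\<^bsub>R\<^esub> c)" using that(1-4) by algebra
    then show ?thesis using that(5,6) by simp
  qed
  have mulI: "(b \<otimes>\<^bsub>R\<^esub> d) \<ominus>\<^bsub>R\<^esub> (a \<otimes>\<^bsub>R\<^esub> c) \<in> I"
    if "a \<in> carrier R" "b \<in> carrier R" "c \<in> carrier R" "d \<in> carrier R" "b \<ominus>\<^bsub>R\<^esub> a \<in> I" "d \<ominus>\<^bsub>R\<^esub> c \<in> I" for a b c d
  proof -
    have "(b \<otimes>\<^bsub>R\<^esub> d) \<ominus>\<^bsub>R\<^esub> (a \<otimes>\<^bsub>R\<^esub> c) = d \<otimes>\<^bsub>R\<^esub> (b \<ominus>\<^bsub>R\<^esub> a) \<oplus>\<^bsub>R\<^esub> a \<otimes>\<^bsub>R\<^esub> (d \<ominus>\<^bsub>R\<^esub> c)" using that(1-4) by algebra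
    then show ?thesis using that by (simp add: I.I_l_closed)
  qed
  have negI: "(\<ominus>\<^bsub>R\<^esub> b) \<ominus>\<^bsub>R\<^esub> (\<ominus>\<^bsub>R\<^esub> a) \<in> I" if "a \<in> carrier R" "b \<in> carrier R" "b \<ominus>\<^bsub>R\<^esub> a \<in> I" for a b
  proof -
    have "(\<ominus>\<^bsub>R\<^esub> b) \<ominus>\<^bsub>R\<^esub> (\<ominus>\<^bsub>R\<^esub> a) = \<ominus>\<^bsub>R\<^esub> (b \<ominus>\<^bsub>R\<^esub> a)" using that by algebra
    then show ?thesis using that by simp
  qed
  have self: "a \<ominus>\<^bsub>R\<^esub> a \<in> I" if "a \<in> carrier R" for a using that by (simp add: minus_eq r_neg)
  note ops = amalgamated_duplication_simps(2-)
  show ?thesis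
  proof (rule cringI)
    show "abelian_group (amalgamated_duplication R I)"
    proof (rule abelian_groupI)
      fix p assume p: "p \<in> carrier (amalgamated_duplication R I)"
      then show "\<exists>q\<in>carrier (amalgamated_duplication R I).
          q \<oplus>\<^bsub>amalgamated_duplication R I\<^esub> p = \<zero>\<^bsub>amalgamated_duplication R I\<^esub>"
        by (intro bexI[of _ "(\<ominus>\<^bsub>R\<^esub> fst p, \<ominus>\<^bsub>R\<^esub> snd p)"]) (auto simp: car ops l_neg negI)
    qed (auto simp: car ops addI self a_ac)
    show "comm_monoid (amalgamated_duplication R I)"
      by (rule comm_monoidI) (auto simp: car ops mulI self m_ac)
  qed (auto simp: car ops l_distr)
qed

end

theory Submission
  imports Defs
begin

text \<open>
  Everything reduces to one elementary condition on a set \<open>J\<close> of ring elements, here called locally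
  unital: each \<open>x \<in> J\<close> satisfies \<open>e x = x\<close> for some \<open>e \<in> J\<close>.

  A ring is a PF-ring exactly when all annihilators \<open>ann a\<close> are locally unital
  (\<open>PF_ring_iff_locally_unital_annihilators\<close>). Behind this is the isomorphism of
  \<open>R a \<otimes> N\<close> with \<open>N / ann(a) N\<close>, which sends \<open>r a \<otimes> n\<close> to the class of \<open>r n\<close>. Its two halves are
  \<open>tensor_principal_reduce\<close> (every tensor has the form \<open>a \<otimes> n\<close>) and \<open>tensor_principal_detect\<close>
  (if \<open>a \<otimes> n = 0\<close>, then \<open>n\<close> lies in every submodule that contains \<open>ann(a) N\<close>). If \<open>R a\<close> is flat and
  \<open>x a = 0\<close>, then \<open>a \<otimes> x\<close> vanishes in \<open>R a \<otimes> R\<close>, hence in \<open>R a \<otimes> R x\<close>, and so \<open>x\<close> lies in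
  \<open>ann(a) x\<close>. Conversely, if \<open>ann a\<close> is locally unital, then the elements of \<open>ann(a) N\<close> are those
  fixed by some \<open>e \<in> ann a\<close>, and whether \<open>e\<close> fixes an element can be tested after an injective
  linear map.

  An ideal is pure exactly when it is locally unital (\<open>pure_ideal_iff_locally_unital\<close>): the
  localizations provide, at each maximal ideal, a denominator that moves \<open>i\<close> into \<open>I i\<close>, and these
  denominators generate the unit ideal.

  With both translations the theorem is a computation with pairs. If the annihilators in \<open>R \<bowtie> I\<close> are
  locally unital, the diagonal elements \<open>(a, a)\<close> give the condition for \<open>ann a\<close>, and the products
  \<open>(0, i) (i, 0) = 0\<close> give it for \<open>I\<close>. In the other direction, suppose \<open>(x, y) (a, b) = 0\<close>, and let \<open>e\<close>
  and \<open>f\<close> be local units for \<open>x\<close> in \<open>ann a\<close> and for \<open>y\<close> in \<open>ann b\<close>. The pair \<open>(e, f)\<close> need not lie in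
  \<open>R \<bowtie> I\<close>, so \<open>f\<close> is replaced by the interpolation \<open>(1 - u) e + u f\<close>, where \<open>u \<in> I\<close> fixes both \<open>b - a\<close>
  and \<open>y - x\<close>: on the part where \<open>u\<close> acts as \<open>0\<close> the two coordinates agree, and \<open>e\<close> serves for both.
\<close>

section \<open>Locally unital sets and annihilators\<close>

definition locally_unital :: "('a, 'r) ring_scheme \<Rightarrow> 'a set \<Rightarrow> bool"
  where "locally_unital R J \<longleftrightarrow> (\<forall>x\<in>J. \<exists>e\<in>J. e \<otimes>\<^bsub>R\<^esub> x = x)"

definition annihilator :: "('a, 'r) ring_scheme \<Rightarrow> 'a \<Rightarrow> 'a set"
  where "annihilator R a = {x \<in> carrier R. x \<otimes>\<^bsub>R\<^esub> a = \<zero>\<^bsub>R\<^esub>}"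

lemma (in cring) idealI_closed:
  assumes "J \<subseteq> carrier R" "\<zero> \<in> J"
    and "\<And>x y. x \<in> J \<Longrightarrow> y \<in> J \<Longrightarrow> x \<oplus> y \<in> J"
    and "\<And>r x. r \<in> carrier R \<Longrightarrow> x \<in> J \<Longrightarrow> r \<otimes> x \<in> J"
  shows "ideal J R"
proof (rule idealI[OF ring_axioms])
  have neg: "\<ominus> x \<in> J" if "x \<in> J" for x
    using assms(4)[of "\<ominus> \<one>" x] that assms(1) by (auto simp: l_minus)
  show "subgroup J (add_monoid R)"
    by (rule subgroup.intro) (use assms neg in \<open>auto simp: a_inv_def[symmetric]\<close>)
  show "x \<otimes> y \<in> J" "y \<otimes> x \<in> J" if "y \<in> J" "x \<in> carrier R" for x y
    using assms(1) assms(4)[OF that(2,1)] that by (auto simp: m_comm)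
qed

lemma (in cring) ideal_annihilator:
  assumes "a \<in> carrier R"
  shows "ideal (annihilator R a) R"
  by (rule idealI_closed) (use assms in \<open>auto simp: annihilator_def l_distr m_assoc\<close>)

text \<open>Local units combine by \<open>1 - g = (1 - e) (1 - f)\<close>, so two elements always have a common one.\<close>
lemma (in cring) locally_unital_common:
  assumes "ideal J R" "locally_unital R J" "x \<in> J" "y \<in> J"
  shows "\<exists>g\<in>J. g \<otimes> x = x \<and> g \<otimes> y = y"
proof -
  interpret J: ideal J R by fact
  obtain e f where ef: "e \<in> J" "e \<otimes> x = x" "f \<in> J" "f \<otimes> y = y"
    using assms unfolding locally_unital_def by meson
  note c = J.Icarr[OF assms(3)] J.Icarr[OF assms(4)] J.Icarr[OF ef(1)] J.Icarr[OF ef(3)]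
  have "(e \<oplus> f \<ominus> e \<otimes> f) \<otimes> x = e \<otimes> x \<oplus> f \<otimes> x \<ominus> f \<otimes> (e \<otimes> x)"
    using c by algebra
  also have "\<dots> = x" using c unfolding ef(2) by algebra
  finally have 1: "(e \<oplus> f \<ominus> e \<otimes> f) \<otimes> x = x" .
  have "(e \<oplus> f \<ominus> e \<otimes> f) \<otimes> y = e \<otimes> y \<oplus> f \<otimes> y \<ominus> e \<otimes> (f \<otimes> y)"
    using c by algebra
  also have "\<dots> = y" using c unfolding ef(4) by algebra
  finally have 2: "(e \<oplus> f \<ominus> e \<otimes> f) \<otimes> y = y" .
  have "e \<oplus> f \<ominus> e \<otimes> f \<in> J"
    using ef c by (simp add: minus_eq J.I_l_closed)
  with 1 2 show ?thesis by blast
qed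


section \<open>Tensor products with a principal ideal\<close>

lemma tensor_kernel_zero_left:
  assumes "module R M" "module R N" "y \<in> carrier N"
  shows "frag_of (\<zero>\<^bsub>M\<^esub>, y) \<in> tensor_kernel R M N"
proof -
  interpret M: module R M by fact
  have "frag_of (\<zero>\<^bsub>M\<^esub> \<oplus>\<^bsub>M\<^esub> \<zero>\<^bsub>M\<^esub>, y) - frag_of (\<zero>\<^bsub>M\<^esub>, y) - frag_of (\<zero>\<^bsub>M\<^esub>, y) \<in> tensor_relations R M N"
    using assms(3) M.M.zero_closed unfolding tensor_relations_def by blast
  from tensor_kernel_diff[OF assms(1,2) tensor_kernel_zero tensor_kernel_rel[OF this]]
  show ?thesis by simp
qed

lemma tensor_kernel_zero_right:
  assumes "module R M" "module R N" "x \<in> carrier M"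
  shows "frag_of (x, \<zero>\<^bsub>N\<^esub>) \<in> tensor_kernel R M N"
proof -
  interpret N: module R N by fact
  have "frag_of (x, \<zero>\<^bsub>N\<^esub> \<oplus>\<^bsub>N\<^esub> \<zero>\<^bsub>N\<^esub>) - frag_of (x, \<zero>\<^bsub>N\<^esub>) - frag_of (x, \<zero>\<^bsub>N\<^esub>) \<in> tensor_relations R M N"
    using assms(3) N.M.zero_closed unfolding tensor_relations_def by blast
  from tensor_kernel_diff[OF assms(1,2) tensor_kernel_zero tensor_kernel_rel[OF this]]
  show ?thesis by simp
qed

lemma tensor_kernel_ideal_smult:
  assumes "r \<in> carrier R" "x \<in> J" "y \<in> carrier N"
  shows "frag_of (r \<otimes>\<^bsub>R\<^esub> x, y) - frag_of (x, r \<odot>\<^bsub>N\<^esub> y) \<in> tensor_kernel R (ideal_module R J) N"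
proof -
  have "r \<otimes>\<^bsub>R\<^esub> x = r \<odot>\<^bsub>ideal_module R J\<^esub> x" "x \<in> carrier (ideal_module R J)"
    using assms(2) by (simp_all add: ideal_module_def)
  then show ?thesis
    using assms(1,3) by (intro tensor_kernel_rel) (auto simp: tensor_relations_def)
qed

text \<open>Scalars move across the tensor sign, \<open>r a \<otimes> n = a \<otimes> r n\<close>, so a sum of pure tensors collapses
  to a single one with first factor \<open>a\<close>.\<close>
lemma tensor_principal_reduce:
  assumes "cring R" "a \<in> carrier R" "module R N"
    and "Poly_Mapping.keys z \<subseteq> (PIdl\<^bsub>R\<^esub> a) \<times> carrier N"
  shows "\<exists>n\<in>carrier N. z - frag_of (a, n) \<in> tensor_kernel R (ideal_module R (PIdl\<^bsub>R\<^esub> a)) N"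
  using assms(4)
proof (induction z rule: frag_induction)
  interpret cring R by fact
  interpret N: module R N by fact
  let ?M = "ideal_module R (PIdl\<^bsub>R\<^esub> a)"
  let ?K = "tensor_kernel R ?M N"
  have M: "module R ?M" by (rule module_ideal_module[OF assms(1) cgenideal_ideal[OF assms(2)]])
  have a: "a \<in> carrier ?M" by (simp add: ideal_module_def cgenideal_self assms(2))
  note kdiff = tensor_kernel_diff[OF M assms(3)]
  have radd: "frag_of (a, n \<oplus>\<^bsub>N\<^esub> m) - frag_of (a, n) - frag_of (a, m) \<in> ?K"
    if "n \<in> carrier N" "m \<in> carrier N" for n m
    by (rule tensor_kernel_rel) (use that a in \<open>auto simp: tensor_relations_def\<close>)
  {
    case zero
    from kdiff[OF tensor_kernel_zero tensor_kernel_zero_right[OF M assms(3) a]]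
    show ?case by (intro bexI[of _ "\<zero>\<^bsub>N\<^esub>"]) simp_all
  next
    case (one p)
    then obtain r n where p: "p = (r \<otimes>\<^bsub>R\<^esub> a, n)" "r \<in> carrier R" "n \<in> carrier N"
      by (auto simp: cgenideal_def)
    then show ?case
      using tensor_kernel_ideal_smult[OF p(2) cgenideal_self[OF assms(2)] p(3)]
      by (intro bexI[of _ "r \<odot>\<^bsub>N\<^esub> n"]) simp_all
  next
    case (diff z w)
    then obtain n m where n: "n \<in> carrier N" "z - frag_of (a, n) \<in> ?K"
      and m: "m \<in> carrier N" "w - frag_of (a, m) \<in> ?K" by blast
    have "(n \<ominus>\<^bsub>N\<^esub> m) \<oplus>\<^bsub>N\<^esub> m = n"
      using n m by (simp add: N.M.minus_eq N.M.a_assoc N.M.l_neg)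
    then have "frag_of (a, n) - frag_of (a, n \<ominus>\<^bsub>N\<^esub> m) - frag_of (a, m) \<in> ?K"
      using radd[of "n \<ominus>\<^bsub>N\<^esub> m" m] n m by simp
    from kdiff[OF kdiff[OF n(2) m(2)] kdiff[OF tensor_kernel_zero this]]
    have "z - w - frag_of (a, n \<ominus>\<^bsub>N\<^esub> m) \<in> ?K" by (simp add: algebra_simps)
    then show ?case using n m by blast
  }
qed

text \<open>The rule \<open>r a \<otimes> n \<mapsto> r n\<close> is ambiguous only up to \<open>ann(a) N\<close>, because \<open>r\<close> is determined by \<open>r a\<close>
  up to \<open>ann a\<close>. Choosing a coefficient \<open>c x\<close> with \<open>c x a = x\<close> for each \<open>x \<in> R a\<close> gives a
  homomorphism \<open>h\<close> from the free abelian group to \<open>N\<close> that takes every tensor relation into \<open>P\<close>, so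
  \<open>a \<otimes> n = 0\<close> forces \<open>c a n \<in> P\<close>; and \<open>n - c a n\<close> lies in \<open>ann(a) N\<close>.\<close>
lemma tensor_principal_detect:
  fixes R (structure)
  assumes "cring R" "a \<in> carrier R" "module R N" "submodule P R N"
    and ann: "\<And>e y. e \<in> annihilator R a \<Longrightarrow> y \<in> carrier N \<Longrightarrow> e \<odot>\<^bsub>N\<^esub> y \<in> P"
    and "n \<in> carrier N"
    and "frag_of (a, n) \<in> tensor_kernel R (ideal_module R (PIdl\<^bsub>R\<^esub> a)) N"
  shows "n \<in> P"
proof -
  interpret cring R by fact
  interpret N: module R N by fact
  let ?M = "ideal_module R (PIdl\<^bsub>R\<^esub> a)"
  have M: "module R ?M" by (rule module_ideal_module[OF assms(1) cgenideal_ideal[OF assms(2)]])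
  interpret M: module R ?M by (rule M)
  note PE = N.submoduleE[OF assms(4)]
  have Pc: "p \<in> carrier N" if "p \<in> P" for p using PE(1) that by auto
  have P0: "\<zero>\<^bsub>N\<^esub> \<in> P"
    using ann[of "\<zero>" "\<zero>\<^bsub>N\<^esub>"] assms(2) by (simp add: annihilator_def)
  obtain c where c: "c x \<in> carrier R" "c x \<otimes> a = x" if "x \<in> PIdl a" for x
  proof -
    have "\<forall>x\<in>PIdl a. \<exists>r\<in>carrier R. r \<otimes> a = x" by (auto simp: cgenideal_def)
    then show ?thesis using that by metis
  qed
  let ?F = "tensor_free ?M N"
  have "(\<lambda>(x, y). c x \<odot>\<^bsub>N\<^esub> y) ` (carrier ?M \<times> carrier N) \<subseteq> carrier (add_monoid N)"
    using c by (auto simp: ideal_module_def)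
  then obtain h where hom: "h \<in> hom ?F (add_monoid N)"
    and "\<And>p. p \<in> carrier ?M \<times> carrier N \<Longrightarrow> h (frag_of p) = (\<lambda>(x, y). c x \<odot>\<^bsub>N\<^esub> y) p"
    by (rule comm_group.free_Abelian_group_universal[OF N.a_comm_group]) blast
  then have h: "h (frag_of (x, y)) = c x \<odot>\<^bsub>N\<^esub> y" if "x \<in> PIdl a" "y \<in> carrier N" for x y
    using that by (fastforce simp: ideal_module_def)
  interpret h: group_hom ?F "add_monoid N" h
    by (intro group_hom.intro group_hom_axioms.intro group_free_Abelian_group hom
        comm_group.axioms(2)[OF N.a_comm_group])
  have hc: "h z \<in> carrier N" if "Poly_Mapping.keys z \<subseteq> carrier ?M \<times> carrier N" for z
    using h.hom_closed[of z] that by simp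
  have hdiff: "h (z - w) = h z \<ominus>\<^bsub>N\<^esub> h w"
    if "Poly_Mapping.keys z \<subseteq> carrier ?M \<times> carrier N" "Poly_Mapping.keys w \<subseteq> carrier ?M \<times> carrier N" for z w
  proof -
    have "Poly_Mapping.keys (z - w) \<subseteq> carrier ?M \<times> carrier N"
      using keys_diff[of z w] that by blast
    from h.hom_mult[of "z - w" w] this that
    have "h z = h (z - w) \<oplus>\<^bsub>N\<^esub> h w" by simp
    then show ?thesis
      using hc[OF that(1)] hc[OF that(2)] hc[OF \<open>Poly_Mapping.keys (z - w) \<subseteq> _\<close>]
      by (simp add: N.M.minus_eq N.M.a_assoc N.M.r_neg)
  qed
  have car: "carrier ?M = PIdl a" "\<And>x y. x \<oplus>\<^bsub>?M\<^esub> y = x \<oplus> y" "\<And>x y. x \<odot>\<^bsub>?M\<^esub> y = x \<otimes> y"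
    by (simp_all add: ideal_module_def)
  have key: "Poly_Mapping.keys (frag_of (x, y)) \<subseteq> carrier ?M \<times> carrier N"
    if "x \<in> PIdl a" "y \<in> carrier N" for x y using that by (simp add: car)
  have acl: "x \<oplus> x' \<in> PIdl a" if "x \<in> PIdl a" "x' \<in> PIdl a" for x x'
    using M.M.a_closed[of x x'] that by (simp add: car)
  have mcl: "r \<otimes> x \<in> PIdl a" if "r \<in> carrier R" "x \<in> PIdl a" for x r
    using M.smult_closed[of r x] that by (simp add: car)
  \<comment> \<open>Two coefficients of the same multiple of \<open>a\<close> act equally modulo \<open>P\<close>.\<close>
  have PM: "u \<odot>\<^bsub>N\<^esub> y \<ominus>\<^bsub>N\<^esub> v \<odot>\<^bsub>N\<^esub> y \<in> P"
    if "u \<in> carrier R" "v \<in> carrier R" "y \<in> carrier N" "u \<otimes> a = v \<otimes> a" for u v y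
  proof -
    have "(u \<ominus> v) \<otimes> a = u \<otimes> a \<ominus> v \<otimes> a" using that assms(2) by algebra
    then have "u \<ominus> v \<in> annihilator R a"
      using that assms(2) by (simp add: annihilator_def minus_eq r_neg)
    from ann[OF this that(3)] show ?thesis
      using that by (simp add: minus_eq N.M.minus_eq N.smult_l_distr N.smult_l_minus)
  qed
  have "Poly_Mapping.keys z \<subseteq> carrier ?M \<times> carrier N \<and> h z \<in> P"
    if "z \<in> tensor_kernel R ?M N" for z
    using M assms(3) that
  proof (induction rule: tensor_kernel_induct)
    case zero
    show ?case using h.hom_one P0 by simp
  next
    case (rel z)
    then consider
      (1) x x' y where "x \<in> PIdl a" "x' \<in> PIdl a" "y \<in> carrier N"
        "z = frag_of (x \<oplus> x', y) - frag_of (x, y) - frag_of (x', y)"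
    | (2) x y y' where "x \<in> PIdl a" "y \<in> carrier N" "y' \<in> carrier N"
        "z = frag_of (x, y \<oplus>\<^bsub>N\<^esub> y') - frag_of (x, y) - frag_of (x, y')"
    | (3) r x y where "r \<in> carrier R" "x \<in> PIdl a" "y \<in> carrier N"
        "z = frag_of (r \<otimes> x, y) - frag_of (x, r \<odot>\<^bsub>N\<^esub> y)"
      unfolding tensor_relations_def car by blast
    then have "h z \<in> P"
    proof cases
      case 1
      note cs = acl[OF 1(1,2)] 1(1-3)
      have "h z = c (x \<oplus> x') \<odot>\<^bsub>N\<^esub> y \<ominus>\<^bsub>N\<^esub> c x \<odot>\<^bsub>N\<^esub> y \<ominus>\<^bsub>N\<^esub> c x' \<odot>\<^bsub>N\<^esub> y"
        using cs unfolding 1(4) by (subst hdiff, simp_all add: hdiff key h keys_frag_diffs car)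
      also have "\<dots> = c (x \<oplus> x') \<odot>\<^bsub>N\<^esub> y \<ominus>\<^bsub>N\<^esub> (c x \<oplus> c x') \<odot>\<^bsub>N\<^esub> y"
        using c cs by (simp add: N.smult_l_distr N.M.minus_eq N.M.minus_add N.M.a_assoc)
      also have "\<dots> \<in> P"
        using c cs assms(2) by (intro PM) (simp_all add: l_distr)
      finally show ?thesis .
    next
      case 2
      have "h z = c x \<odot>\<^bsub>N\<^esub> (y \<oplus>\<^bsub>N\<^esub> y') \<ominus>\<^bsub>N\<^esub> c x \<odot>\<^bsub>N\<^esub> y \<ominus>\<^bsub>N\<^esub> c x \<odot>\<^bsub>N\<^esub> y'"
        using 2 unfolding 2(4) by (subst hdiff, simp_all add: hdiff key h keys_frag_diffs car)
      also have "\<dots> = c x \<odot>\<^bsub>N\<^esub> (y \<oplus>\<^bsub>N\<^esub> y') \<ominus>\<^bsub>N\<^esub> c x \<odot>\<^bsub>N\<^esub> (y \<oplus>\<^bsub>N\<^esub> y')"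
        using 2 c by (simp add: N.smult_r_distr N.M.minus_eq N.M.minus_add N.M.a_assoc)
      also have "\<dots> \<in> P" using c 2 by (intro PM) simp_all
      finally show ?thesis .
    next
      case 3
      note cs = mcl[OF 3(1,2)] 3(1-3)
      have "h z = c (r \<otimes> x) \<odot>\<^bsub>N\<^esub> y \<ominus>\<^bsub>N\<^esub> c x \<odot>\<^bsub>N\<^esub> (r \<odot>\<^bsub>N\<^esub> y)"
        using cs unfolding 3(4) by (subst hdiff) (simp_all add: key h car)
      also have "\<dots> = c (r \<otimes> x) \<odot>\<^bsub>N\<^esub> y \<ominus>\<^bsub>N\<^esub> (r \<otimes> c x) \<odot>\<^bsub>N\<^esub> y"
        using cs c by (simp add: N.smult_assoc1[symmetric] m_comm)
      also have "\<dots> \<in> P"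
        using c cs assms(2) by (intro PM) (simp_all add: m_assoc)
      finally show ?thesis .
    qed
    moreover have "Poly_Mapping.keys z \<subseteq> carrier ?M \<times> carrier N"
      using subsetD[OF tensor_relations_subset[OF M assms(3)] rel] by simp
    ultimately show ?case by blast
  next
    case (diff z w)
    moreover have "Poly_Mapping.keys (z - w) \<subseteq> carrier ?M \<times> carrier N"
      using keys_diff[of z w] diff by blast
    ultimately show ?case using PE by (simp add: hdiff N.M.minus_eq)
  qed
  from this[OF assms(7)] have ca: "c a \<odot>\<^bsub>N\<^esub> n \<in> P"
    using h[of a n] assms by (simp add: cgenideal_self)
  have "\<one> \<odot>\<^bsub>N\<^esub> n \<ominus>\<^bsub>N\<^esub> c a \<odot>\<^bsub>N\<^esub> n \<in> P"
    using c[of a] assms(2,6) by (intro PM) (simp_all add: cgenideal_self)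
  from PE(5)[OF this ca] show "n \<in> P"
    using Pc[OF ca] assms(6) by (simp add: N.M.minus_eq N.M.a_assoc N.M.l_neg)
qed


section \<open>Flatness of principal ideals\<close>

text \<open>Flatness is tested on the inclusion of \<open>R x\<close> into \<open>R\<close>. In \<open>R a \<otimes> R\<close> the tensor \<open>a \<otimes> x\<close> equals
  \<open>x a \<otimes> 1 = 0\<close>, so it already vanishes in \<open>R a \<otimes> R x\<close>; with \<open>P = ann(a) x\<close>, detection gives
  \<open>x \<in> ann(a) x\<close>.\<close>
lemma flat_principal_imp_locally_unital_annihilator:
  fixes R (structure)
  assumes "cring R" "a \<in> carrier R" "flat R (ideal_module R (PIdl\<^bsub>R\<^esub> a))"
  shows "locally_unital R (annihilator R a)"
  unfolding locally_unital_def
proof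
  interpret cring R by fact
  let ?M = "ideal_module R (PIdl a)"
  have M: "module R ?M" by (rule module_ideal_module[OF assms(1) cgenideal_ideal[OF assms(2)]])
  fix x assume "x \<in> annihilator R a"
  then have x: "x \<in> carrier R" "x \<otimes> a = \<zero>" by (auto simp: annihilator_def)
  let ?N = "ideal_module R (PIdl x)" and ?N' = "ideal_module R (carrier R)"
  have N: "module R ?N" by (rule module_ideal_module[OF assms(1) cgenideal_ideal[OF x(1)]])
  have N': "module R ?N'" by (rule module_ideal_module[OF assms(1) oneideal])
  interpret N: module R ?N by (rule N)
  have idx: "x \<in> PIdl x" by (rule cgenideal_self[OF x(1)])
  have ida: "a \<in> PIdl a" by (rule cgenideal_self[OF assms(2)])
  have sub: "PIdl x \<subseteq> carrier R" using x by (auto simp: cgenideal_def)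
  have hom: "(\<lambda>y. y) \<in> module_hom R ?N ?N'"
    using sub by (auto simp: module_hom_def ideal_module_def)
  have inj: "inj_on (tensor_map R ?M ?N' (\<lambda>y. y)) (carrier (tensor_product R ?M ?N))"
    by (rule flat_imp_inj_tensor_map[OF assms(3) N N' hom inj_on_id2])
  have "tensor_free_map (\<lambda>y. y) (frag_of (a, x)) \<in> tensor_kernel R ?M ?N'"
  proof -
    have "frag_of (x \<otimes> a, \<one>) - frag_of (a, x \<otimes> \<one>) \<in> tensor_kernel R ?M ?N'"
      using tensor_kernel_ideal_smult[OF x(1) ida, of \<one> ?N'] by (simp add: ideal_module_def)
    then have "frag_of (\<zero>, \<one>) - frag_of (a, x) \<in> tensor_kernel R ?M ?N'"
      using x by simp
    moreover have "frag_of (\<zero>, \<one>) \<in> tensor_kernel R ?M ?N'"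
      using tensor_kernel_zero_left[OF M N', of \<one>] by (simp add: ideal_module_def)
    ultimately have "frag_of (\<zero>, \<one>) - (frag_of (\<zero>, \<one>) - frag_of (a, x)) \<in> tensor_kernel R ?M ?N'"
      using tensor_kernel_diff[OF M N'] by blast
    then show ?thesis by (simp add: tensor_free_map_of)
  qed
  then have k: "frag_of (a, x) \<in> tensor_kernel R ?M ?N"
    using inj idx ida unfolding inj_on_tensor_map_iff[OF M N N' hom]
    by (simp add: ideal_module_def)
  let ?P = "{e \<otimes> x | e. e \<in> annihilator R a}"
  interpret A: ideal "annihilator R a" R by (rule ideal_annihilator[OF assms(2)])
  have PN: "?P \<subseteq> carrier ?N"
    using A.Icarr by (auto simp: ideal_module_def cgenideal_def)
  interpret P: ideal ?P R
  proof (rule idealI_closed)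
    show "?P \<subseteq> carrier R" using A.Icarr x by auto
    show "\<zero> \<in> ?P" using A.zero_closed x by (auto intro!: exI[of _ \<zero>])
    fix u assume "u \<in> ?P"
    then obtain e where e: "u = e \<otimes> x" "e \<in> annihilator R a" by auto
    show "r \<otimes> u \<in> ?P" if "r \<in> carrier R" for r
      using that e x A.Icarr A.I_l_closed by (auto intro!: exI[of _ "r \<otimes> e"] simp: m_assoc)
    show "u \<oplus> v \<in> ?P" if "v \<in> ?P" for v
    proof -
      from that obtain f where f: "v = f \<otimes> x" "f \<in> annihilator R a" by auto
      show ?thesis
        using f e x A.Icarr by (auto intro!: exI[of _ "e \<oplus> f"] simp: l_distr)
    qed
  qed
  have "submodule ?P R ?N"
  proof (rule N.submoduleI)
    show "?P \<subseteq> carrier ?N" by (rule PN)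
    show "\<zero>\<^bsub>?N\<^esub> \<in> ?P" using P.zero_closed by (simp add: ideal_module_def)
    fix u assume u: "u \<in> ?P"
    show "v \<oplus>\<^bsub>?N\<^esub> u \<in> ?P" if "v \<in> ?P" for v
      using P.a_closed[OF that u] by (simp add: ideal_module_def)
    show sm: "r \<odot>\<^bsub>?N\<^esub> u \<in> ?P" if "r \<in> carrier R" for r
      using P.I_l_closed[OF u that] by (simp add: ideal_module_def)
    have "\<ominus>\<^bsub>?N\<^esub> u = (\<ominus> \<one>) \<odot>\<^bsub>?N\<^esub> u"
      using u PN N.smult_l_minus[of \<one> u] by auto
    then show "\<ominus>\<^bsub>?N\<^esub> u \<in> ?P" using sm[of "\<ominus> \<one>"] by simp
  qed
  moreover have "e \<odot>\<^bsub>?N\<^esub> y \<in> ?P" if e: "e \<in> annihilator R a" and "y \<in> carrier ?N" for e y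
  proof -
    from that obtain r where r: "y = r \<otimes> x" "r \<in> carrier R"
      by (auto simp: ideal_module_def cgenideal_def)
    have "e \<odot>\<^bsub>?N\<^esub> y = (e \<otimes> r) \<otimes> x"
      using r x A.Icarr[OF e] by (simp add: ideal_module_def m_assoc)
    then show ?thesis using A.I_r_closed[OF e r(2)] by blast
  qed
  moreover have "x \<in> carrier ?N" using idx by (simp add: ideal_module_def)
  ultimately have "x \<in> ?P"
    using tensor_principal_detect[OF assms(1,2) N _ _ _ k] by blast
  then obtain e where "e \<in> annihilator R a" "x = e \<otimes> x" by blast
  then show "\<exists>e\<in>annihilator R a. e \<otimes> x = x" by metis
qed

text \<open>A tensor in the kernel is reduced to \<open>a \<otimes> n\<close>. The elements of the target that are fixed by some
  \<open>e \<in> ann a\<close> form a submodule containing \<open>ann(a) N'\<close>, so detection applied to \<open>a \<otimes> f n = 0\<close> gives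
  \<open>e (f n) = f n\<close>. Injectivity of \<open>f\<close> returns \<open>e n = n\<close>, whence \<open>a \<otimes> n = e a \<otimes> n = 0\<close>.\<close>
lemma locally_unital_annihilator_imp_flat_principal:
  fixes R (structure)
  assumes "cring R" "a \<in> carrier R" "locally_unital R (annihilator R a)"
  shows "flat R (ideal_module R (PIdl\<^bsub>R\<^esub> a))"
proof -
  interpret cring R by fact
  let ?M = "ideal_module R (PIdl a)"
  interpret A: ideal "annihilator R a" R by (rule ideal_annihilator[OF assms(2)])
  have M: "module R ?M" by (rule module_ideal_module[OF assms(1) cgenideal_ideal[OF assms(2)]])
  have ida: "a \<in> PIdl a" by (rule cgenideal_self[OF assms(2)])
  have "inj_on (tensor_map R ?M N' f) (carrier (tensor_product R ?M N))"
    if N: "module R N" and N': "module R N'" and f: "f \<in> module_hom R N N'"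
      and inj: "inj_on f (carrier N)"
    for N N' :: "('a, 'a list set) module" and f
    unfolding inj_on_tensor_map_iff[OF M N N' f]
  proof (intro allI impI)
    interpret N: module R N by (rule N)
    interpret N': module R N' by (rule N')
    fix z assume z: "Poly_Mapping.keys z \<subseteq> carrier ?M \<times> carrier N"
      and fz: "tensor_free_map f z \<in> tensor_kernel R ?M N'"
    obtain n where n: "n \<in> carrier N" "z - frag_of (a, n) \<in> tensor_kernel R ?M N"
      using tensor_principal_reduce[OF assms(1,2) N, of z] z by (auto simp: ideal_module_def)
    have fn: "f n \<in> carrier N'" using f n by (auto simp: module_hom_def)
    have "frag_of (a, f n) \<in> tensor_kernel R ?M N'"
      using tensor_kernel_diff[OF M N' fz tensor_kernel_map[OF M N N' f n(2)]]
      by (simp add: tensor_free_map_simps)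
    define P where "P = {y \<in> carrier N'. \<exists>e\<in>annihilator R a. e \<odot>\<^bsub>N'\<^esub> y = y}"
    have smP: "r \<odot>\<^bsub>N'\<^esub> y \<in> P" if r: "r \<in> carrier R" and "y \<in> P" for r y
    proof -
      from that obtain e where y: "y \<in> carrier N'" and e: "e \<in> annihilator R a" "e \<odot>\<^bsub>N'\<^esub> y = y"
        by (auto simp: P_def)
      have "e \<odot>\<^bsub>N'\<^esub> (r \<odot>\<^bsub>N'\<^esub> y) = r \<odot>\<^bsub>N'\<^esub> (e \<odot>\<^bsub>N'\<^esub> y)"
        using y r A.Icarr[OF e(1)] by (simp add: N'.smult_assoc1[symmetric] m_comm)
      then show ?thesis using e y r by (auto simp: P_def)
    qed
    have "submodule P R N'"
    proof (rule N'.submoduleI)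
      show "P \<subseteq> carrier N'" by (auto simp: P_def)
      show "\<zero>\<^bsub>N'\<^esub> \<in> P"
        using A.zero_closed N'.smult_r_null[OF A.Icarr[OF A.zero_closed]] unfolding P_def by blast
      fix y assume y: "y \<in> P"
      have yc: "y \<in> carrier N'" using y by (simp add: P_def)
      show "r \<odot>\<^bsub>N'\<^esub> y \<in> P" if "r \<in> carrier R" for r using smP[OF that y] .
      show "\<ominus>\<^bsub>N'\<^esub> y \<in> P"
        using smP[of "\<ominus> \<one>" y] y N'.smult_l_minus[of \<one> y] yc by simp
      fix w assume w: "w \<in> P"
      obtain e e' where e: "e \<in> annihilator R a" "e \<odot>\<^bsub>N'\<^esub> y = y"
        and e': "e' \<in> annihilator R a" "e' \<odot>\<^bsub>N'\<^esub> w = w" using y w by (auto simp: P_def)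
      obtain g where g: "g \<in> annihilator R a" "g \<otimes> e = e" "g \<otimes> e' = e'"
        using locally_unital_common[OF A.ideal_axioms assms(3) e(1) e'(1)] by blast
      have wc: "w \<in> carrier N'" using w by (simp add: P_def)
      have gy: "g \<odot>\<^bsub>N'\<^esub> y = y"
        using N'.smult_assoc1[of g e y] g e yc A.Icarr by simp
      have gw: "g \<odot>\<^bsub>N'\<^esub> w = w"
        using N'.smult_assoc1[of g e' w] g e' wc A.Icarr by simp
      have "g \<odot>\<^bsub>N'\<^esub> (y \<oplus>\<^bsub>N'\<^esub> w) = y \<oplus>\<^bsub>N'\<^esub> w"
        using gy gw yc wc A.Icarr[OF g(1)] by (simp add: N'.smult_r_distr)
      then show "y \<oplus>\<^bsub>N'\<^esub> w \<in> P" using g(1) yc wc by (auto simp: P_def)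
    qed
    moreover have "e \<odot>\<^bsub>N'\<^esub> y \<in> P" if e: "e \<in> annihilator R a" and y: "y \<in> carrier N'" for e y
    proof -
      obtain g where g: "g \<in> annihilator R a" "g \<otimes> e = e"
        using assms(3) e unfolding locally_unital_def by blast
      have "g \<odot>\<^bsub>N'\<^esub> (e \<odot>\<^bsub>N'\<^esub> y) = e \<odot>\<^bsub>N'\<^esub> y"
        using N'.smult_assoc1[of g e y] g e y A.Icarr by simp
      then show ?thesis using g(1) y A.Icarr[OF e] by (auto simp: P_def)
    qed
    ultimately have "f n \<in> P"
      using tensor_principal_detect[OF assms(1,2) N' _ _ fn] \<open>frag_of (a, f n) \<in> _\<close> by blast
    then obtain e where e: "e \<in> annihilator R a" "e \<odot>\<^bsub>N'\<^esub> f n = f n" by (auto simp: P_def)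
    have ec: "e \<in> carrier R" and ea: "e \<otimes> a = \<zero>"
      using e(1) unfolding annihilator_def by blast+
    have "f (e \<odot>\<^bsub>N\<^esub> n) = f n"
      using f e(2) ec n(1) by (simp add: module_hom_def)
    from inj_onD[OF inj this] have en: "e \<odot>\<^bsub>N\<^esub> n = n" using n(1) ec by simp
    have "frag_of (e \<otimes> a, n) - frag_of (a, e \<odot>\<^bsub>N\<^esub> n) \<in> tensor_kernel R ?M N"
      by (rule tensor_kernel_ideal_smult[OF ec ida n(1)])
    then have 1: "frag_of (\<zero>, n) - frag_of (a, n) \<in> tensor_kernel R ?M N"
      unfolding en ea .
    have 2: "frag_of (\<zero>, n) \<in> tensor_kernel R ?M N"
      using tensor_kernel_zero_left[OF M N n(1)] by (simp add: ideal_module_def)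
    note kd = tensor_kernel_diff[OF M N]
    from kd[OF kd[OF n(2) 1] kd[OF tensor_kernel_zero 2]]
    show "z \<in> tensor_kernel R ?M N" by simp
  qed
  then show ?thesis using M unfolding flat_def by simp
qed

lemma PF_ring_iff_locally_unital_annihilators:
  fixes R (structure)
  assumes "cring R"
  shows "PF_ring R \<longleftrightarrow> (\<forall>a\<in>carrier R. locally_unital R (annihilator R a))"
proof -
  interpret cring R by fact
  have "principalideal J R \<longleftrightarrow> (\<exists>a\<in>carrier R. J = PIdl a)" for J
    using cgenideal_is_principalideal principalideal.generate cgenideal_eq_genideal by metis
  then have "PF_ring R \<longleftrightarrow> (\<forall>a\<in>carrier R. flat R (ideal_module R (PIdl a)))"
    by (auto simp: PF_ring_def assms)
  moreover have "flat R (ideal_module R (PIdl a)) \<longleftrightarrow> locally_unital R (annihilator R a)"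
    if "a \<in> carrier R" for a
    using flat_principal_imp_locally_unital_annihilator[OF assms that]
      locally_unital_annihilator_imp_flat_principal[OF assms that] by (rule iffI)
  ultimately show ?thesis by simp
qed


section \<open>Purity of ideals\<close>

lemma (in cring) exists_maximalideal:
  assumes "ideal J R" "\<one> \<notin> J"
  shows "\<exists>m. maximalideal m R \<and> J \<subseteq> m"
proof -
  define S where "S = {H. ideal H R \<and> J \<subseteq> H \<and> \<one> \<notin> H}"
  have "\<exists>m\<in>S. \<forall>H\<in>S. m \<subseteq> H \<longrightarrow> H = m"
  proof (rule subset_Zorn_nonempty)
    show "S \<noteq> {}" using assms by (auto simp: S_def)
    fix C assume C: "C \<noteq> {}" "subset.chain S C"
    then have "subset.chain {H. ideal H R} C"
      unfolding pred_on.chain_def S_def by blast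
    then have "ideal (\<Union>C) R" using chain_Union_is_ideal[of C] C(1) by simp
    then show "\<Union>C \<in> S" using C unfolding pred_on.chain_def S_def by blast
  qed
  then obtain m where mS: "m \<in> S" and max: "\<And>H. H \<in> S \<Longrightarrow> m \<subseteq> H \<Longrightarrow> H = m" by blast
  have m: "ideal m R" "J \<subseteq> m" "\<one> \<notin> m" using mS by (simp_all add: S_def)
  have "maximalideal m R"
  proof (rule maximalidealI[OF m(1)])
    show "carrier R \<noteq> m" using m(3) by auto
    fix H assume H: "ideal H R" "m \<subseteq> H" "H \<subseteq> carrier R"
    show "H = m \<or> H = carrier R"
    proof (cases "\<one> \<in> H")
      case True
      then show ?thesis using ideal.one_imp_carrier[OF H(1)] by simp
    next
      case False
      then have "H \<in> S" using H(1,2) m(2) by (auto simp: S_def)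
      then show ?thesis using max H(2) by simp
    qed
  qed
  with m(2) show ?thesis by blast
qed

lemma (in cring) submonoid_maximalideal_complement:
  assumes "maximalideal m R"
  shows "submonoid (carrier R - m) R"
proof -
  interpret primeideal m R by (rule maximalideal_prime[OF assms])
  show ?thesis
  proof
    show "carrier R - m \<subseteq> carrier R" by blast
    show "x \<otimes> y \<in> carrier R - m" if "x \<in> carrier R - m" "y \<in> carrier R - m" for x y
      using that I_prime[of x y] by auto
    show "\<one> \<in> carrier R - m" using one_imp_carrier I_notcarr by auto
  qed
qed

lemma (in cring) fraction_eq_zero_iff:
  assumes "submonoid S R" "r \<in> carrier R" "s \<in> S"
  shows "fraction R S r s = \<zero>\<^bsub>localization R S\<^esub> \<longleftrightarrow> (\<exists>t\<in>S. t \<otimes> r = \<zero>)"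
proof -
  interpret S: submonoid S R by fact
  have "r \<otimes> \<one> \<ominus> \<zero> \<otimes> s = r"
    using assms(2) subsetD[OF S.subset assms(3)] by (simp add: minus_eq)
  then show ?thesis
    using fraction_eq_iff[OF is_cring assms zero_closed S.one_closed]
    by (simp add: localization_def)
qed

lemma (in cring) localized_ideal_eq_zero_iff:
  assumes "submonoid S R" "ideal I R"
  shows "localized_ideal R S I = {\<zero>\<^bsub>localization R S\<^esub>} \<longleftrightarrow> (\<forall>i\<in>I. \<exists>s\<in>S. s \<otimes> i = \<zero>)"
proof -
  interpret S: submonoid S R by fact
  interpret I: ideal I R by fact
  let ?z = "\<zero>\<^bsub>localization R S\<^esub>"
  have frac: "fraction R S i s = ?z \<longleftrightarrow> (\<exists>t\<in>S. t \<otimes> i = \<zero>)" if "i \<in> I" "s \<in> S" for i s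
    by (rule fraction_eq_zero_iff[OF assms(1) I.Icarr[OF that(1)] that(2)])
  have mem: "fraction R S i s \<in> localized_ideal R S I" if "i \<in> I" "s \<in> S" for i s
    using that unfolding localized_ideal_def by blast
  show ?thesis
  proof
    assume eq: "localized_ideal R S I = {?z}"
    show "\<forall>i\<in>I. \<exists>s\<in>S. s \<otimes> i = \<zero>"
    proof
      fix i assume i: "i \<in> I"
      show "\<exists>s\<in>S. s \<otimes> i = \<zero>"
        using mem[OF i S.one_closed] frac[OF i S.one_closed] by (simp add: eq)
    qed
  next
    assume ann: "\<forall>i\<in>I. \<exists>s\<in>S. s \<otimes> i = \<zero>"
    have "fraction R S i s = ?z" if "i \<in> I" "s \<in> S" for i s
      using frac[OF that] ann that(1) by simp
    then have "localized_ideal R S I \<subseteq> {?z}" unfolding localized_ideal_def by blast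
    moreover have "?z \<in> localized_ideal R S I"
      using mem[OF I.zero_closed S.one_closed] by (simp add: localization_def)
    ultimately show "localized_ideal R S I = {?z}" by (intro subset_antisym) simp_all
  qed
qed

lemma (in cring) localized_ideal_eq_carrier_iff:
  assumes "submonoid S R" "ideal I R"
  shows "localized_ideal R S I = carrier (localization R S) \<longleftrightarrow> I \<inter> S \<noteq> {}" (is "?L = ?C \<longleftrightarrow> _")
proof
  interpret S: submonoid S R by fact
  interpret I: ideal I R by fact
  have Sc: "s \<in> carrier R" if "s \<in> S" for s using that S.subset by blast
  {
    assume eq: "?L = ?C"
    have "\<exists>r s. fraction R S \<one> \<one> = fraction R S r s \<and> r \<in> carrier R \<and> s \<in> S"
      using S.one_closed by blast
    then have "fraction R S \<one> \<one> \<in> ?C" by (simp add: localization_def)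
    then have "fraction R S \<one> \<one> \<in> ?L" using eq by simp
    then obtain j s where j: "j \<in> I" "s \<in> S" "fraction R S \<one> \<one> = fraction R S j s"
      unfolding localized_ideal_def by blast
    note jc = I.Icarr[OF j(1)]
    obtain t where t: "t \<in> S" "t \<otimes> (\<one> \<otimes> s \<ominus> j \<otimes> \<one>) = \<zero>"
      using fraction_eq_iff[OF is_cring assms(1) one_closed S.one_closed jc j(2)] j(3) by blast
    \<comment> \<open>\<open>1 / 1 = j / s\<close> says that \<open>t s = t j\<close>, an element of \<open>S\<close> and of \<open>I\<close>.\<close>
    have "t \<otimes> s = t \<otimes> (\<one> \<otimes> s \<ominus> j \<otimes> \<one>) \<oplus> t \<otimes> j"
      using Sc[OF t(1)] Sc[OF j(2)] jc by algebra
    then have "t \<otimes> s = t \<otimes> j" unfolding t(2) using Sc[OF t(1)] jc by simp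
    then have "t \<otimes> s \<in> I" using I.I_l_closed[OF j(1) Sc[OF t(1)]] by simp
    then show "I \<inter> S \<noteq> {}" using S.m_closed[OF t(1) j(2)] by blast
  next
    assume "I \<inter> S \<noteq> {}"
    then obtain i where i: "i \<in> I" "i \<in> S" by blast
    have "fraction R S r s \<in> ?L" if r: "r \<in> carrier R" and s: "s \<in> S" for r s
    proof -
      have "\<one> \<otimes> (r \<otimes> (i \<otimes> s) \<ominus> (i \<otimes> r) \<otimes> s) = \<zero>"
        using r Sc[OF s] Sc[OF i(2)] by algebra
      then have "\<exists>t\<in>S. t \<otimes> (r \<otimes> (i \<otimes> s) \<ominus> (i \<otimes> r) \<otimes> s) = \<zero>"
        by (rule bexI[OF _ S.one_closed])
      then have "fraction R S r s = fraction R S (i \<otimes> r) (i \<otimes> s)"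
        unfolding fraction_eq_iff[OF is_cring assms(1) r s m_closed[OF Sc[OF i(2)] r] S.m_closed[OF i(2) s]] .
      then show ?thesis
        using I.I_r_closed[OF i(1) r] S.m_closed[OF i(2) s] unfolding localized_ideal_def by blast
    qed
    moreover have C: "?C = {fraction R S r s | r s. r \<in> carrier R \<and> s \<in> S}"
      by (simp add: localization_def)
    ultimately have "?C \<subseteq> ?L" by auto
    moreover have "?L \<subseteq> ?C"
      unfolding C localized_ideal_def using I.Icarr by blast
    ultimately show "?L = ?C" by simp
  }
qed

text \<open>If \<open>I\<close> is not contained in \<open>m\<close>, then an element of \<open>I\<close> outside \<open>m\<close> becomes a unit at \<open>m\<close> and
  \<open>I\<^sub>m = R\<^sub>m\<close>; purity has content only at the maximal ideals that contain \<open>I\<close>.\<close>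
lemma (in cring) pure_ideal_iff:
  assumes "ideal I R"
  shows "pure_ideal I R \<longleftrightarrow>
    (\<forall>m. maximalideal m R \<longrightarrow> I \<subseteq> m \<longrightarrow> (\<forall>i\<in>I. \<exists>s\<in>carrier R - m. s \<otimes> i = \<zero>))"
proof -
  interpret I: ideal I R by fact
  have "I \<inter> (carrier R - m) \<noteq> {} \<longleftrightarrow> \<not> I \<subseteq> m" for m
    using I.Icarr by blast
  then show ?thesis
    unfolding pure_ideal_def
    using assms localized_ideal_eq_zero_iff[OF submonoid_maximalideal_complement assms]
      localized_ideal_eq_carrier_iff[OF submonoid_maximalideal_complement assms] by auto
qed

text \<open>A local unit \<open>e \<in> I \<subseteq> m\<close> of \<open>i\<close> yields the denominator \<open>1 - e \<notin> m\<close> that kills \<open>i\<close>. For the converse,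
  the ideal of all \<open>r\<close> with \<open>r i \<in> I i\<close> contains \<open>I\<close>, and by purity it lies in no maximal ideal; hence
  it contains \<open>1\<close>.\<close>
lemma (in cring) pure_ideal_iff_locally_unital:
  assumes "ideal I R"
  shows "pure_ideal I R \<longleftrightarrow> locally_unital R I"
proof
  interpret I: ideal I R by fact
  {
    assume lu: "locally_unital R I"
    have "\<exists>s\<in>carrier R - m. s \<otimes> i = \<zero>" if m: "maximalideal m R" "I \<subseteq> m" and i: "i \<in> I" for m i
    proof -
      interpret m: maximalideal m R by (rule m(1))
      obtain e where e: "e \<in> I" "e \<otimes> i = i" using lu i unfolding locally_unital_def by blast
      note ec = I.Icarr[OF e(1)] and ic = I.Icarr[OF i]
      have "(\<one> \<ominus> e) \<otimes> i = i \<ominus> e \<otimes> i" using ec ic by algebra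
      then have "(\<one> \<ominus> e) \<otimes> i = \<zero>" using ic by (simp add: e(2) minus_eq r_neg)
      moreover have "\<one> \<ominus> e \<notin> m"
      proof
        assume "\<one> \<ominus> e \<in> m"
        then have "(\<one> \<ominus> e) \<oplus> e \<in> m" using m(2) e(1) by blast
        moreover have "(\<one> \<ominus> e) \<oplus> e = \<one>" using ec by algebra
        ultimately show False using m.one_imp_carrier m.I_notcarr by simp
      qed
      moreover have "\<one> \<ominus> e \<in> carrier R" using ec by simp
      ultimately show ?thesis by blast
    qed
    then show "pure_ideal I R" unfolding pure_ideal_iff[OF assms] by blast
  }
  {
    assume pure: "pure_ideal I R"
    show "locally_unital R I"
      unfolding locally_unital_def
    proof (rule ballI, rule ccontr)
      fix i assume i: "i \<in> I" and no: "\<not> (\<exists>e\<in>I. e \<otimes> i = i)"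
      note ic = I.Icarr[OF i]
      define J where "J = {r \<in> carrier R. \<exists>e\<in>I. r \<otimes> i = e \<otimes> i}"
      have "ideal J R"
      proof (rule idealI_closed)
        show "J \<subseteq> carrier R" by (auto simp: J_def)
        show "\<zero> \<in> J" using I.zero_closed by (auto simp: J_def)
        fix x assume "x \<in> J"
        then obtain e where x: "x \<in> carrier R" "e \<in> I" "x \<otimes> i = e \<otimes> i" by (auto simp: J_def)
        show "r \<otimes> x \<in> J" if r: "r \<in> carrier R" for r
          using r x ic I.Icarr I.I_l_closed[OF x(2) r]
          by (auto simp: J_def m_assoc intro!: bexI[of _ "r \<otimes> e"])
        fix y assume "y \<in> J"
        then obtain f where y: "y \<in> carrier R" "f \<in> I" "y \<otimes> i = f \<otimes> i" by (auto simp: J_def)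
        show "x \<oplus> y \<in> J"
          using x y ic I.Icarr by (auto simp: J_def l_distr intro!: bexI[of _ "e \<oplus> f"])
      qed
      moreover have "\<one> \<notin> J" using no ic by (auto simp: J_def)
      ultimately obtain m where m: "maximalideal m R" "J \<subseteq> m" using exists_maximalideal by blast
      have "I \<subseteq> J" using I.Icarr unfolding J_def by blast
      then have "I \<subseteq> m" using m(2) by (rule subset_trans)
      from pure[unfolded pure_ideal_iff[OF assms], rule_format, OF m(1) this i]
      obtain s where s: "s \<in> carrier R - m" "s \<otimes> i = \<zero>" by (rule bexE)
      have "s \<otimes> i = \<zero> \<otimes> i" unfolding s(2) using ic by simp
      then have "s \<in> J" using s(1) I.zero_closed unfolding J_def by blast
      then have "s \<in> m" by (rule subsetD[OF m(2)])
      with s(1) show False by simp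
    qed
  }
qed


section \<open>Annihilators in the amalgamated duplication\<close>

lemma (in cring) mem_amalgamated_duplication_iff:
  assumes "ideal I R"
  shows "(x, y) \<in> carrier (amalgamated_duplication R I) \<longleftrightarrow>
    x \<in> carrier R \<and> y \<in> carrier R \<and> y \<ominus> x \<in> I" (is "?L \<longleftrightarrow> ?R")
proof
  interpret I: ideal I R by fact
  {
    assume ?L
    then obtain i where i: "x \<in> carrier R" "i \<in> I" "y = x \<oplus> i"
      by (auto simp: amalgamated_duplication_simps)
    moreover have "x \<oplus> i \<ominus> x = i" using i(1) I.Icarr[OF i(2)] by algebra
    ultimately show ?R using I.Icarr by simp
  next
    assume r: ?R
    then have "y = x \<oplus> (y \<ominus> x)" by algebra
    with r show ?L unfolding amalgamated_duplication_simps by blast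
  }
qed

lemma (in cring) mem_annihilator_amalgamated_duplication_iff:
  assumes "ideal I R"
  shows "(x, y) \<in> annihilator (amalgamated_duplication R I) (a, b) \<longleftrightarrow>
    x \<in> annihilator R a \<and> y \<in> annihilator R b \<and> y \<ominus> x \<in> I"
  by (auto simp: annihilator_def mem_amalgamated_duplication_iff[OF assms]
      amalgamated_duplication_simps(2-))

text \<open>For \<open>i \<in> I\<close> the zero product \<open>(i, 0) (0, i) = 0\<close> has a local unit \<open>(g, h)\<close> with \<open>g i = i\<close> and
  \<open>h i = 0\<close>; then \<open>g - h\<close> fixes \<open>i\<close>, and it lies in \<open>I\<close> because \<open>(g, h)\<close> is in \<open>R \<bowtie> I\<close>.\<close>
lemma (in cring) amalgamated_duplication_annihilators_imp:
  assumes "ideal I R"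
    and lu: "\<And>p. p \<in> carrier (amalgamated_duplication R I) \<Longrightarrow>
      locally_unital (amalgamated_duplication R I) (annihilator (amalgamated_duplication R I) p)"
  shows "a \<in> carrier R \<Longrightarrow> locally_unital R (annihilator R a)"
    and "locally_unital R I"
proof -
  interpret I: ideal I R by fact
  note mem = mem_amalgamated_duplication_iff[OF assms(1)]
    mem_annihilator_amalgamated_duplication_iff[OF assms(1)]
  have local_unit: "\<exists>g h. g \<in> annihilator R a \<and> h \<in> annihilator R b \<and> h \<ominus> g \<in> I \<and>
      g \<otimes> x = x \<and> h \<otimes> y = y"
    if ab: "(a, b) \<in> carrier (amalgamated_duplication R I)"
      and xy: "(x, y) \<in> annihilator (amalgamated_duplication R I) (a, b)" for a b x y
  proof -
    obtain p where p: "p \<in> annihilator (amalgamated_duplication R I) (a, b)"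
      "p \<otimes>\<^bsub>amalgamated_duplication R I\<^esub> (x, y) = (x, y)"
      using lu[OF ab] xy unfolding locally_unital_def by blast
    obtain g h where "p = (g, h)" by (cases p)
    with p have "g \<in> annihilator R a \<and> h \<in> annihilator R b \<and> h \<ominus> g \<in> I \<and> g \<otimes> x = x \<and> h \<otimes> y = y"
      unfolding mem by (simp add: mem amalgamated_duplication_simps(3))
    then show ?thesis by blast
  qed
  have self: "x \<ominus> x \<in> I" if "x \<in> carrier R" for x
    using that by (simp add: minus_eq r_neg)
  show "locally_unital R (annihilator R a)" if a: "a \<in> carrier R"
    unfolding locally_unital_def
  proof
    fix x assume x: "x \<in> annihilator R a"
    then have "x \<in> carrier R" by (simp add: annihilator_def)
    then have "(a, a) \<in> carrier (amalgamated_duplication R I)"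
      "(x, x) \<in> annihilator (amalgamated_duplication R I) (a, a)"
      using x a self unfolding mem by simp_all
    from local_unit[OF this] show "\<exists>e\<in>annihilator R a. e \<otimes> x = x" by blast
  qed
  show "locally_unital R I"
    unfolding locally_unital_def
  proof
    fix i assume i: "i \<in> I"
    note ic = I.Icarr[OF i]
    have 1: "(\<zero>, i) \<in> carrier (amalgamated_duplication R I)"
      using i ic by (simp add: mem minus_eq)
    have 2: "(i, \<zero>) \<in> annihilator (amalgamated_duplication R I) (\<zero>, i)"
      using i ic unfolding mem by (simp add: annihilator_def minus_eq)
    obtain g h where gh: "g \<in> carrier R" "h \<in> carrier R" "h \<otimes> i = \<zero>" "h \<ominus> g \<in> I" "g \<otimes> i = i"
      using local_unit[OF 1 2] unfolding annihilator_def by blast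
    have "(\<ominus> (h \<ominus> g)) \<otimes> i = g \<otimes> i \<ominus> h \<otimes> i" using gh(1,2) ic by algebra
    also have "\<dots> = i" unfolding gh(3,5) using ic by (simp add: minus_eq)
    finally show "\<exists>e\<in>I. e \<otimes> i = i" using I.a_inv_closed[OF gh(4)] by blast
  qed
qed

text \<open>The second coordinate \<open>h = (1 - u) e + u f\<close> differs from \<open>e\<close> by \<open>u (f - e) \<in> I\<close>. It kills \<open>b\<close> since
  \<open>(1 - u) b = (1 - u) a\<close>, and it fixes \<open>y\<close> since \<open>(1 - u) y = (1 - u) x\<close>.\<close>
lemma (in cring) annihilators_imp_amalgamated_duplication:
  assumes "ideal I R" "locally_unital R I"
    and lu: "\<And>a. a \<in> carrier R \<Longrightarrow> locally_unital R (annihilator R a)"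
    and p: "p \<in> carrier (amalgamated_duplication R I)"
  shows "locally_unital (amalgamated_duplication R I) (annihilator (amalgamated_duplication R I) p)"
  unfolding locally_unital_def
proof
  interpret I: ideal I R by fact
  note mem = mem_amalgamated_duplication_iff[OF assms(1)]
    mem_annihilator_amalgamated_duplication_iff[OF assms(1)]
  fix q assume q: "q \<in> annihilator (amalgamated_duplication R I) p"
  obtain a b x y where pq: "p = (a, b)" "q = (x, y)" by (metis surj_pair)
  have ab: "a \<in> carrier R" "b \<in> carrier R" "b \<ominus> a \<in> I" using p by (simp_all add: pq mem)
  have xy: "x \<in> annihilator R a" "y \<in> annihilator R b" "y \<ominus> x \<in> I" using q by (simp_all add: pq mem)
  obtain e where e: "e \<in> carrier R" "e \<otimes> a = \<zero>" "e \<otimes> x = x"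
    using lu[OF ab(1)] xy(1) unfolding locally_unital_def annihilator_def by blast
  obtain f where f: "f \<in> carrier R" "f \<otimes> b = \<zero>" "f \<otimes> y = y"
    using lu[OF ab(2)] xy(2) unfolding locally_unital_def annihilator_def by blast
  obtain u where u: "u \<in> I" "u \<otimes> (b \<ominus> a) = b \<ominus> a" "u \<otimes> (y \<ominus> x) = y \<ominus> x"
    using locally_unital_common[OF assms(1,2) ab(3) xy(3)] by blast
  have c: "a \<in> carrier R" "b \<in> carrier R" "x \<in> carrier R" "y \<in> carrier R" "e \<in> carrier R" "f \<in> carrier R"
    "u \<in> carrier R"
    using ab xy e f I.Icarr[OF u(1)] by (auto simp: annihilator_def)
  define h where "h = e \<oplus> u \<otimes> (f \<ominus> e)"
  have hc: "h \<in> carrier R" using c by (simp add: h_def)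
  \<comment> \<open>The right-hand side isolates the products \<open>f b\<close>, \<open>e a\<close> and \<open>u (b - a)\<close>, whose values are known;
    the computation of \<open>h y\<close> is arranged in the same way.\<close>
  have "h \<otimes> b = u \<otimes> (f \<otimes> b) \<oplus> e \<otimes> a \<oplus> e \<otimes> ((b \<ominus> a) \<ominus> u \<otimes> (b \<ominus> a)) \<ominus> u \<otimes> (e \<otimes> a)"
    using c unfolding h_def by algebra
  also have "\<dots> = \<zero>" using c unfolding e(2) f(2) u(2) by algebra
  finally have hb: "h \<otimes> b = \<zero>" .
  have "h \<otimes> y = u \<otimes> (f \<otimes> y) \<oplus> e \<otimes> x \<oplus> e \<otimes> ((y \<ominus> x) \<ominus> u \<otimes> (y \<ominus> x)) \<ominus> u \<otimes> (e \<otimes> x)"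
    using c unfolding h_def by algebra
  also have "\<dots> = u \<otimes> y \<ominus> u \<otimes> x \<oplus> x"
    using c unfolding e(3) f(3) u(3) by algebra
  also have "\<dots> = u \<otimes> (y \<ominus> x) \<oplus> x" using c by algebra
  also have "\<dots> = y" using c unfolding u(3) by algebra
  finally have hy: "h \<otimes> y = y" .
  have "h \<ominus> e = u \<otimes> (f \<ominus> e)" using c unfolding h_def by algebra
  then have "h \<ominus> e \<in> I" using I.I_r_closed[OF u(1)] c by simp
  then have "(e, h) \<in> annihilator (amalgamated_duplication R I) p"
    using e hb hc unfolding pq mem by (simp add: annihilator_def)
  moreover have "(e, h) \<otimes>\<^bsub>amalgamated_duplication R I\<^esub> q = q"
    using e(3) hy by (simp add: pq amalgamated_duplication_simps(3))
  ultimately show "\<exists>k\<in>annihilator (amalgamated_duplication R I) p.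
      k \<otimes>\<^bsub>amalgamated_duplication R I\<^esub> q = q" by blast
qed

theorem theorem2p9:
  fixes R :: "('a, 'r) ring_scheme" and I :: "'a set"
  assumes "cring R" and "ideal I R"
  shows "PF_ring (amalgamated_duplication R I) \<longleftrightarrow> PF_ring R \<and> pure_ideal I R"
proof -
  interpret cring R by fact
  show ?thesis
    unfolding PF_ring_iff_locally_unital_annihilators[OF assms(1)]
      PF_ring_iff_locally_unital_annihilators[OF cring_amalgamated_duplication[OF assms]]
      pure_ideal_iff_locally_unital[OF assms(2)]
    using amalgamated_duplication_annihilators_imp[OF assms(2)]
      annihilators_imp_amalgamated_duplication[OF assms(2)] by blast
qed

end
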